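(* There exists an infinite family $\{T_n\}_{n\in\mathbb{N}}$ of twisted knots such that all the $T_n$ have the same $Q$-polynomial, i.e. $Q_{T_n}(s,t)=Q_{T_m}(s,t)$ for all $n,m\in\mathbb{N}$, but their $Q^z$-polynomials are pairwise distinct, i.e. $Q^{z}_{T_n}(s,t)\neq Q^{z}_{T_m}(s,t)$ whenever $n\neq m$.
   Context: Twisted knot diagrams. An oriented twisted knot diagram $K$ is a generic immersed oriented closed curve in $\mathbb{R}^2$ with finitely many transverse double points, each marked either as a classical crossing (with over/under information) or as a virtual crossing (no over/under information), together with finitely many bars (short transverse marks) on the curve away from the double points. Diagrams are considered up to planar isotopy. $C(K)$ is the set of classical crossings and $sgn(c)=sign(c)\in\{+1,-1\}$ is the usual sign of $c\in C(K)$. A twisted knot is an equivalence class of such diagrams under the Reidemeister moves $C_1,C_2,C_3,V_1,V_2,V_3,V_4,T_1,T_2,T_3$; the $Q$- and $Q^z$-polynomials of a twisted knot are those of any diagram representing it. Reidemeister moves. $C_1,C_2,C_3$ are the usual classical Reidemeister moves; $V_1,V_2,V_3$ are the same moves with all crossings virtual; $V_4$ moves an arc having two consecutive virtual crossings across a classical crossing. $T_1$ inserts or deletes two adjacent bars on an arc. $T_2$ slides a bar along its strand through a virtual crossing. $T_3$ replaces a classical crossing $c$ having a bar on each of its four adjacent arcs (one before and one after $c$ on each strand) by a bar-free tangle with the same end points and the same connectivity in which the two strands cross first virtually, then at one classical crossing $c'$, then again virtually; the strand that is over at $c$ is under at $c'$, and $sgn(c')=sgn(c)$. All orientations are allowed.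 Smoothing. For $c\in C(K)$, let $K_c$ be the two-component diagram obtained by the oriented smoothing at $c$, its components labelled $0$ and $1$ (which component gets which label does not affect the polynomials $Q_K$ and $Q^z_K$). Affine index. For $l\in\{0,1\}$, traverse the $l$-component of $K_c$ once along its orientation starting near $c$, and let $\gamma_1,\dots,\gamma_{k_l}$ be the sequence of classical crossings met (with repetition). Put $\epsilon_i=0$ if the traversal passes under at $\gamma_i$ and $\epsilon_i=1$ if it passes over. Then $ind^{\,l}(c,K)=\sum_{i=1}^{k_l}(-1)^{\epsilon_i}sign(\gamma_i)$. (Self-crossings of the $l$-component contribute zero, and $ind^{\,1}(c,K)=-ind^{\,0}(c,K)$.) Let $\bar\rho^{\,l}(c)\in\{0,1\}$ be the parity of $ind^{\,l}(c,K)$. Bar parity. For $c\in C(K)$, $p^l(c)\in\{0,1\}$ is the parity of the number of bars on the $l$-component of $K_c$. The $Q$-polynomial. $Q_{K}(s,t)=\sum_{c\in C(K)}sgn(c)\bigl(s^{\bar\rho^{0}(c)}t^{p^{0}(c)}-1\bigr)\bigl(s^{\bar\rho^{1}(c)}t^{p^{1}(c)}-1\bigr)$. Zero crossings. $c\in C(K)$ is a zero crossing if $ind^{\,l}(c,K)$ is even for $l=0$ or $1$ (equivalently both). $ZC(K)$ is the set of zero crossings. For $c\in ZC(K)$ the zero affine index is $zind^{\,l}(c,K)=\sum_{\gamma_i\in ZC(K)}(-1)^{\epsilon_i}sign(\gamma_i)$, the sum being over those terms of the sequence $\gamma_1,\dots,\gamma_{k_l}$ of classical crossings met along the $l$-component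 of $K_c$ that are zero crossings of $K$, and $z(c)\in\{0,1\}$ is the residue of $zind^{\,l}(c,K)$ mod $2$ (independent of $l$). The $Q^z$-polynomial. $$Q^{z}_{K}(s,t)=\sum_{c\in ZC(K)}sgn(c)\bigl(s^{z(c)}t^{p^{0}(c)}-1\bigr)\bigl(s^{z(c)}t^{p^{1}(c)}-1\bigr)+\sum_{c\in C(K)\setminus ZC(K)}sgn(c)\bigl(s\,t^{p^{0}(c)}-1\bigr)\bigl(s\,t^{p^{1}(c)}-1\bigr).$$ *)

theory Defs
  imports "HOL-Analysis.Analysis" "HOL-Computational_Algebra.Polynomial"
begin

section \<open>Oriented twisted knot diagrams\<close>

text \<open>
  The plane is the type of complex numbers. A closed curve is a map of period 1 on the reals, and a
  point of the underlying circle is represented by its parameter in \<open>{0..<1}\<close>.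
  A classical crossing is the pair (parameter of the over-pass, parameter of the under-pass);
  a double point that is not listed in \<open>crossings\<close> is a virtual crossing.
  Bars are given by their parameters.
\<close>

record diagram =
  curve :: "real \<Rightarrow> complex"
  crossings :: "(real \<times> real) set"
  bars :: "real set"

definition tangent :: "diagram \<Rightarrow> real \<Rightarrow> complex" where
  "tangent D t = vector_derivative (curve D) (at t)"

text \<open>Each double point of the curve occurs in both orders.\<close>

definition double_points :: "diagram \<Rightarrow> (real \<times> real) set" where
  "double_points D = {(t, u). t \<in> {0..<1} \<and> u \<in> {0..<1} \<and> t \<noteq> u \<and> curve D t = curve D u}"

text \<open>The determinant of the pair of plane vectors \<open>v\<close>, \<open>w\<close>.\<close>

definition plane_det :: "complex \<Rightarrow> complex \<Rightarrow> real" where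
  "plane_det v w = Re v * Im w - Im v * Re w"

definition is_diagram :: "diagram \<Rightarrow> bool" where
  "is_diagram D \<longleftrightarrow>
     (\<forall>t. curve D (t + 1) = curve D t) \<and>
     curve D C1_differentiable_on UNIV \<and>
     (\<forall>t. tangent D t \<noteq> 0) \<and>
     finite (double_points D) \<and>
     (\<forall>t u v. (t, u) \<in> double_points D \<and> (t, v) \<in> double_points D \<longrightarrow> u = v) \<and>
     (\<forall>(t, u) \<in> double_points D. plane_det (tangent D t) (tangent D u) \<noteq> 0) \<and>
     crossings D \<subseteq> double_points D \<and>
     crossings D \<inter> (crossings D)\<inverse> = {} \<and>
     finite (bars D) \<and> bars D \<subseteq> {0..<1} \<and>
     bars D \<inter> Domain (double_points D) = {}"

text \<open>
  A crossing is positive iff the direction of the over-strand is turned counterclockwise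
  (by less than a half turn) to that of the under-strand.
\<close>

definition crossing_sign :: "diagram \<Rightarrow> real \<times> real \<Rightarrow> int" where
  "crossing_sign D c = (if plane_det (tangent D (fst c)) (tangent D (snd c)) > 0 then 1 else -1)"


section \<open>Planar isotopy\<close>

text \<open>
  An ambient isotopy of the plane through \<open>C\<^sup>1\<close> diffeomorphisms. As \<open>H s\<close> is bijective with invertible
  derivatives, its inverse is differentiable, too.
\<close>

definition ambient_isotopy :: "(real \<Rightarrow> complex \<Rightarrow> complex) \<Rightarrow> bool" where
  "ambient_isotopy H \<longleftrightarrow>
     (\<forall>z. H 0 z = z) \<and>
     (\<forall>s\<in>{0..1}. bij (H s)) \<and>
     continuous_on ({0..1} \<times> UNIV) (\<lambda>(s, z). H s z) \<and>
     (\<exists>H'. (\<forall>s\<in>{0..1}. \<forall>z. (H s has_derivative H' s z) (at z) \<and> bij (H' s z)) \<and>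
           (\<forall>v. continuous_on ({0..1} \<times> UNIV) (\<lambda>(s, z). H' s z v)))"

text \<open>Orientation-preserving \<open>C\<^sup>1\<close> diffeomorphisms of the circle, lifted to the reals.\<close>

definition reparametrization :: "(real \<Rightarrow> real) \<Rightarrow> bool" where
  "reparametrization f \<longleftrightarrow>
     f C1_differentiable_on UNIV \<and> (\<forall>t. f (t + 1) = f t + 1) \<and>
     (\<forall>t. vector_derivative f (at t) > 0)"

definition planar_isotopic :: "diagram \<Rightarrow> diagram \<Rightarrow> bool" where
  "planar_isotopic D D' \<longleftrightarrow>
     (\<exists>H f. ambient_isotopy H \<and> reparametrization f \<and>
        (\<forall>t. curve D' t = H 1 (curve D (f t))) \<and>
        crossings D' = {(t, u). t \<in> {0..<1} \<and> u \<in> {0..<1} \<and> (frac (f t), frac (f u)) \<in> crossings D} \<and>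
        bars D' = {t \<in> {0..<1}. frac (f t) \<in> bars D})"


section \<open>Reidemeister moves\<close>

text \<open>
  A move changes a diagram inside a round disc only; by planar isotopy any disc in which a
  move takes place may be assumed to be round. The disc is entered transversally along finitely many
  strands, given by the open parameter intervals \<open>{a<..<b}\<close> for \<open>(a, b)\<close> in the list \<open>ss\<close>. As
  rotations of the parameter circle are part of planar isotopy, the base point \<open>0\<close> of the circle
  may be assumed to lie outside of the disc.
\<close>

definition strand :: "real \<times> real \<Rightarrow> real set" where
  "strand s = {fst s<..<snd s}"

definition strands :: "(real \<times> real) list \<Rightarrow> real set" where
  "strands ss = (\<Union>s\<in>set ss. strand s)"

definition meets_disc :: "complex \<Rightarrow> real \<Rightarrow> (real \<times> real) list \<Rightarrow> diagram \<Rightarrow> bool" where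
  "meets_disc p r ss D \<longleftrightarrow>
     {t \<in> {0..<1}. curve D t \<in> ball p r} = strands ss \<and>
     {t \<in> {0..<1}. curve D t \<in> cball p r} = (\<Union>(a, b)\<in>set ss. {a..b}) \<and>
     (\<forall>(a, b)\<in>set ss. \<forall>t\<in>{a, b}. inner (tangent D t) (curve D t - p) \<noteq> 0 \<and>
        t \<notin> Domain (double_points D) \<and> t \<notin> bars D)"

definition local_change :: "(real \<times> real) list \<Rightarrow> diagram \<Rightarrow> diagram \<Rightarrow> bool" where
  "local_change ss D D' \<longleftrightarrow>
     (\<exists>p r. r > 0 \<and>
        (\<forall>(a, b)\<in>set ss. 0 < a \<and> a < b \<and> b < 1) \<and>
        (\<forall>i<length ss. \<forall>j<length ss. i \<noteq> j \<longrightarrow>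
           {fst (ss ! i)..snd (ss ! i)} \<inter> {fst (ss ! j)..snd (ss ! j)} = {}) \<and>
        meets_disc p r ss D \<and> meets_disc p r ss D') \<and>
     (\<forall>t\<in>{0..<1} - strands ss. curve D t = curve D' t) \<and>
     crossings D - strands ss \<times> strands ss = crossings D' - strands ss \<times> strands ss \<and>
     bars D - strands ss = bars D' - strands ss"

text \<open>
  The part of \<open>D\<close> on the strands \<open>ss\<close> has exactly the classical crossings \<open>X\<close>, the virtual
  crossings \<open>V\<close> (each of them listed in one order only) and the bars \<open>B\<close>.
\<close>

definition tangle ::
  "(real \<times> real) list \<Rightarrow> diagram \<Rightarrow> (real \<times> real) set \<Rightarrow> (real \<times> real) set \<Rightarrow> real set \<Rightarrow> bool" where
  "tangle ss D X V B \<longleftrightarrow>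
     crossings D \<inter> strands ss \<times> strands ss = X \<and>
     (double_points D - (crossings D \<union> (crossings D)\<inverse>)) \<inter> strands ss \<times> strands ss = V \<union> V\<inverse> \<and>
     bars D \<inter> strands ss = B"

text \<open>
  The tangles in the pictures of the moves are determined up to isotopy of the disc (rel boundary)
  by their end points and by the crossings and bars along their strands. So each move is
  described by these data, for all orientations of the strands simultaneously. The conditions on
  crossing signs in C2, C3 and V4 are automatic for arcs in a disc.
\<close>

definition move_C1 :: "diagram \<Rightarrow> diagram \<Rightarrow> bool" where
  "move_C1 D D' \<longleftrightarrow>
     (\<exists>s x y. local_change [s] D D' \<and>
        tangle [s] D {} {} {} \<and> tangle [s] D' {(x, y)} {} {})"

definition move_V1 :: "diagram \<Rightarrow> diagram \<Rightarrow> bool" where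
  "move_V1 D D' \<longleftrightarrow>
     (\<exists>s x y. local_change [s] D D' \<and>
        tangle [s] D {} {} {} \<and> tangle [s] D' {} {(x, y)} {})"

definition move_C2 :: "diagram \<Rightarrow> diagram \<Rightarrow> bool" where
  "move_C2 D D' \<longleftrightarrow>
     (\<exists>s1 s2 x1 x2 y1 y2. local_change [s1, s2] D D' \<and>
        {x1, x2} \<subseteq> strand s1 \<and> {y1, y2} \<subseteq> strand s2 \<and> x1 \<noteq> x2 \<and>
        tangle [s1, s2] D {} {} {} \<and>
        tangle [s1, s2] D' {(x1, y1), (x2, y2)} {} {} \<and>
        crossing_sign D' (x1, y1) = - crossing_sign D' (x2, y2))"

definition move_V2 :: "diagram \<Rightarrow> diagram \<Rightarrow> bool" where
  "move_V2 D D' \<longleftrightarrow>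
     (\<exists>s1 s2 x1 x2 y1 y2. local_change [s1, s2] D D' \<and>
        {x1, x2} \<subseteq> strand s1 \<and> {y1, y2} \<subseteq> strand s2 \<and> x1 \<noteq> x2 \<and>
        tangle [s1, s2] D {} {} {} \<and>
        tangle [s1, s2] D' {} {(x1, y1), (x2, y2)} {})"

text \<open>
  In the third moves strand \<open>i\<close> crosses strand \<open>j\<close> once, at the parameter \<open>xij\<close> (before) and
  \<open>yij\<close> (after) of strand \<open>i\<close>; the two crossings on each strand change their order.
\<close>

definition third_move ::
  "(real \<times> real) list \<Rightarrow>
   real \<Rightarrow> real \<Rightarrow> real \<Rightarrow> real \<Rightarrow> real \<Rightarrow> real \<Rightarrow>
   real \<Rightarrow> real \<Rightarrow> real \<Rightarrow> real \<Rightarrow> real \<Rightarrow> real \<Rightarrow>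
   diagram \<Rightarrow> diagram \<Rightarrow> bool" where
  "third_move ss x12 x13 x21 x23 x31 x32 y12 y13 y21 y23 y31 y32 D D' \<longleftrightarrow>
     length ss = 3 \<and> local_change ss D D' \<and>
     {x12, x13, y12, y13} \<subseteq> strand (ss ! 0) \<and>
     {x21, x23, y21, y23} \<subseteq> strand (ss ! 1) \<and>
     {x31, x32, y31, y32} \<subseteq> strand (ss ! 2) \<and>
     (x12 < x13 \<longleftrightarrow> y13 < y12) \<and> (x21 < x23 \<longleftrightarrow> y23 < y21) \<and> (x31 < x32 \<longleftrightarrow> y32 < y31)"

text \<open>In C3 strand 1 is the top strand, strand 2 the middle one and strand 3 the bottom one.\<close>

definition move_C3 :: "diagram \<Rightarrow> diagram \<Rightarrow> bool" where
  "move_C3 D D' \<longleftrightarrow>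
     (\<exists>ss x12 x13 x21 x23 x31 x32 y12 y13 y21 y23 y31 y32.
        third_move ss x12 x13 x21 x23 x31 x32 y12 y13 y21 y23 y31 y32 D D' \<and>
        tangle ss D {(x12, x21), (x13, x31), (x23, x32)} {} {} \<and>
        tangle ss D' {(y12, y21), (y13, y31), (y23, y32)} {} {} \<and>
        crossing_sign D (x12, x21) = crossing_sign D' (y12, y21) \<and>
        crossing_sign D (x13, x31) = crossing_sign D' (y13, y31) \<and>
        crossing_sign D (x23, x32) = crossing_sign D' (y23, y32))"

definition move_V3 :: "diagram \<Rightarrow> diagram \<Rightarrow> bool" where
  "move_V3 D D' \<longleftrightarrow>
     (\<exists>ss x12 x13 x21 x23 x31 x32 y12 y13 y21 y23 y31 y32.
        third_move ss x12 x13 x21 x23 x31 x32 y12 y13 y21 y23 y31 y32 D D' \<and>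
        tangle ss D {} {(x12, x21), (x13, x31), (x23, x32)} {} \<and>
        tangle ss D' {} {(y12, y21), (y13, y31), (y23, y32)} {})"

text \<open>In V4 strand 1 is the arc with the two virtual crossings.\<close>

definition move_V4 :: "diagram \<Rightarrow> diagram \<Rightarrow> bool" where
  "move_V4 D D' \<longleftrightarrow>
     (\<exists>ss x12 x13 x21 x23 x31 x32 y12 y13 y21 y23 y31 y32.
        third_move ss x12 x13 x21 x23 x31 x32 y12 y13 y21 y23 y31 y32 D D' \<and>
        tangle ss D {(x23, x32)} {(x12, x21), (x13, x31)} {} \<and>
        tangle ss D' {(y23, y32)} {(y12, y21), (y13, y31)} {} \<and>
        crossing_sign D (x23, x32) = crossing_sign D' (y23, y32))"

definition move_T1 :: "diagram \<Rightarrow> diagram \<Rightarrow> bool" where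
  "move_T1 D D' \<longleftrightarrow>
     (\<exists>s p q. local_change [s] D D' \<and> p \<noteq> q \<and>
        tangle [s] D {} {} {} \<and> tangle [s] D' {} {} {p, q})"

definition move_T2 :: "diagram \<Rightarrow> diagram \<Rightarrow> bool" where
  "move_T2 D D' \<longleftrightarrow>
     (\<exists>s1 s2 x y p x' y' p'. local_change [s1, s2] D D' \<and>
        {x, p, x', p'} \<subseteq> strand s1 \<and> {y, y'} \<subseteq> strand s2 \<and>
        p < x \<and> x' < p' \<and>
        tangle [s1, s2] D {} {(x, y)} {p} \<and> tangle [s1, s2] D' {} {(x', y')} {p'})"

text \<open>
  In T3 strand 1 is over at the crossing on the left-hand side. Strand 2 runs through the three
  crossings on the right-hand side in the same order as strand 1 or in the opposite order,
  depending on the orientations.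
\<close>

definition move_T3 :: "diagram \<Rightarrow> diagram \<Rightarrow> bool" where
  "move_T3 D D' \<longleftrightarrow>
     (\<exists>s1 s2 x y p p' q q' x1 x2 x3 y1 y2 y3. local_change [s1, s2] D D' \<and>
        {p, x, p', x1, x2, x3} \<subseteq> strand s1 \<and> {q, y, q', y1, y2, y3} \<subseteq> strand s2 \<and>
        p < x \<and> x < p' \<and> q < y \<and> y < q' \<and>
        x1 < x2 \<and> x2 < x3 \<and> (y1 < y2 \<and> y2 < y3 \<or> y3 < y2 \<and> y2 < y1) \<and>
        tangle [s1, s2] D {(x, y)} {} {p, p', q, q'} \<and>
        tangle [s1, s2] D' {(y2, x2)} {(x1, y1), (x3, y3)} {} \<and>
        crossing_sign D (x, y) = crossing_sign D' (y2, x2))"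


section \<open>Twisted knots\<close>

definition diagram_step :: "diagram \<Rightarrow> diagram \<Rightarrow> bool" where
  "diagram_step D D' \<longleftrightarrow>
     is_diagram D \<and> is_diagram D' \<and>
     (planar_isotopic D D' \<or>
      move_C1 D D' \<or> move_C2 D D' \<or> move_C3 D D' \<or>
      move_V1 D D' \<or> move_V2 D D' \<or> move_V3 D D' \<or> move_V4 D D' \<or>
      move_T1 D D' \<or> move_T2 D D' \<or> move_T3 D D')"

definition diagram_equiv :: "(diagram \<times> diagram) set" where
  "diagram_equiv = {(D, D'). is_diagram D \<and> is_diagram D' \<and> equivclp diagram_step D D'}"

definition twisted_knots :: "diagram set set" where
  "twisted_knots = {D. is_diagram D} // diagram_equiv"


section \<open>The polynomials\<close>

text \<open>
  The cyclic open interval from \<open>a\<close> to \<open>b\<close> in the parameter circle. Oriented smoothing at a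
  crossing cuts the circle at the two parameters of the crossing, and the components of the smoothed
  diagram are the two resulting intervals.
\<close>

definition circle_arc :: "real \<Rightarrow> real \<Rightarrow> real set" where
  "circle_arc a b = (if a < b then {a<..<b} else {a<..<1} \<union> {0..<b})"

definition smoothing_component :: "nat \<Rightarrow> real \<times> real \<Rightarrow> real set" where
  "smoothing_component l c =
     (if l = 0 then circle_arc (fst c) (snd c) else circle_arc (snd c) (fst c))"

text \<open>
  The passages of the \<open>l\<close>-component of the diagram smoothed at \<open>c\<close> through classical crossings:
  \<open>(g, 1)\<close> is passing over at \<open>g\<close> and \<open>(g, 0)\<close> is passing under at \<open>g\<close>.
\<close>

definition passages :: "diagram \<Rightarrow> nat \<Rightarrow> real \<times> real \<Rightarrow> ((real \<times> real) \<times> nat) set" where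
  "passages D l c =
     {(g, e). g \<in> crossings D \<and>
        (e = 1 \<and> fst g \<in> smoothing_component l c \<or> e = 0 \<and> snd g \<in> smoothing_component l c)}"

definition affine_ind :: "diagram \<Rightarrow> nat \<Rightarrow> real \<times> real \<Rightarrow> int" where
  "affine_ind D l c = (\<Sum>(g, e)\<in>passages D l c. (-1) ^ e * crossing_sign D g)"

definition ind_parity :: "diagram \<Rightarrow> nat \<Rightarrow> real \<times> real \<Rightarrow> nat" where
  "ind_parity D l c = nat (affine_ind D l c mod 2)"

definition bar_parity :: "diagram \<Rightarrow> nat \<Rightarrow> real \<times> real \<Rightarrow> nat" where
  "bar_parity D l c = card (bars D \<inter> smoothing_component l c) mod 2"

definition zero_crossings :: "diagram \<Rightarrow> (real \<times> real) set" where
  "zero_crossings D = {c \<in> crossings D. \<exists>l\<in>{0, 1}. even (affine_ind D l c)}"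

definition zero_affine_ind :: "diagram \<Rightarrow> nat \<Rightarrow> real \<times> real \<Rightarrow> int" where
  "zero_affine_ind D l c =
     (\<Sum>(g, e)\<in>{(g, e) \<in> passages D l c. g \<in> zero_crossings D}. (-1) ^ e * crossing_sign D g)"

text \<open>The parity does not depend on the component, so that component 0 is used.\<close>

definition zero_parity :: "diagram \<Rightarrow> real \<times> real \<Rightarrow> nat" where
  "zero_parity D c = nat (zero_affine_ind D 0 c mod 2)"

text \<open>The variables of the polynomial ring in \<open>s\<close> and \<open>t\<close> over the integers.\<close>

definition var_s :: "int poly poly" where
  "var_s = [:[:0, 1:]:]"

definition var_t :: "int poly poly" where
  "var_t = [:0, 1:]"

definition Q_poly :: "diagram \<Rightarrow> int poly poly" where
  "Q_poly D =
     (\<Sum>c\<in>crossings D. of_int (crossing_sign D c) *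
        (var_s ^ ind_parity D 0 c * var_t ^ bar_parity D 0 c - 1) *
        (var_s ^ ind_parity D 1 c * var_t ^ bar_parity D 1 c - 1))"

definition Qz_poly :: "diagram \<Rightarrow> int poly poly" where
  "Qz_poly D =
     (\<Sum>c\<in>zero_crossings D. of_int (crossing_sign D c) *
        (var_s ^ zero_parity D c * var_t ^ bar_parity D 0 c - 1) *
        (var_s ^ zero_parity D c * var_t ^ bar_parity D 1 c - 1)) +
     (\<Sum>c\<in>crossings D - zero_crossings D. of_int (crossing_sign D c) *
        (var_s * var_t ^ bar_parity D 0 c - 1) *
        (var_s * var_t ^ bar_parity D 1 c - 1))"

end

(* The polynomials depend only on the Gauss diagram of a twisted knot diagram: up to parity, the
   (zero) affine index of a crossing counts the (zero) crossings interlaced with it. Hence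
   invariance is a matter of parities of interlacement numbers. In C3 every two of the three crossings
   of the triangle become interlaced iff they were not before, and an even number of the three is odd,
   so that neither index parity changes where it matters.

   The family lives on the three-fold rosette (2 + cos (2 pi n t)) cis (6 pi t) with n = 3k + 1 and k
   even. Its double points are the pairs of parameters j/(2n) - 1/6, j/(2n) + 1/6, and those for j and l
   are interlaced iff 0 < |j - l| <= 2k, as long as k < j, l <= 5k. Only j = k + 1, ..., 2k, 3k and 5k
   are made classical. The first k crossings are pairwise interlaced and interlaced with 3k, and 5k is
   interlaced with 3k only. So 3k and 5k are the odd crossings, and with opposite signs they cancel in
   both polynomials. The k others are invisible to Q, but each is interlaced with k - 1 zero crossings,
   an odd number, and contributes (s - 1)^2 to Q^z. *)

theory Submission
  imports Defs
begin

section \<open>Gauss diagrams modulo 2\<close>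

text \<open>Once a curve has supplied the cyclic order of its parameters and the crossing signs,
  only finite sets of pairs of reals remain, and each move becomes propositional reasoning modulo 2.
  A diagram is required to be an actual generic curve, so a Gauss diagram for the family has to be
  realised by a curve all of whose double points are known exactly. Unwanted double points can be
  made virtual, hence it is enough to find a curve with sufficiently varied interlacement. A rosette
  with two turns is too simple: its chords are diameters, so all crossings are pairwise interlaced
  and have the same parity, and without bars the two polynomials agree. Three turns are the next
  case. The choice \<open>n = 3 * k + 1\<close> makes \<open>n\<close> prime to 3 through the
  identity \<open>n - 3 * k = 1\<close>, which is what the integrality arguments use. The crossing
  with index \<open>3 * k\<close> flips the index parity of the \<open>k\<close> others while
  staying out of their zero index, provided that it is odd itself; the crossing with index
  \<open>5 * k\<close> makes it odd.\<close>

definition on_arc :: "real \<Rightarrow> real \<Rightarrow> real \<Rightarrow> bool" where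
  "on_arc a b t \<longleftrightarrow> (if a < b then a < t \<and> t < b else a < t \<or> t < b)"

lemma on_arc_iff: "on_arc a b t \<longleftrightarrow> a < b \<and> a < t \<and> t < b \<or> \<not> a < b \<and> (a < t \<or> t < b)"
  by (simp add: on_arc_def)

text \<open>Dropping the bound to the parameter interval makes \<open>on_arc\<close> a pure order
  predicate, so that facts about arcs are propositional consequences of order axioms. This is the
  link to the arcs of the smoothing.\<close>

lemma mem_circle_arc: "t \<in> {0..<1} \<Longrightarrow> t \<in> circle_arc a b \<longleftrightarrow> on_arc a b t"
  by (auto simp: circle_arc_def on_arc_def)

lemma on_arc_swap: "a \<noteq> b \<Longrightarrow> t \<noteq> a \<Longrightarrow> t \<noteq> b \<Longrightarrow> on_arc b a t \<longleftrightarrow> \<not> on_arc a b t"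
  by (auto simp: on_arc_def)

lemma not_arc_ends [simp]: "a \<noteq> b \<Longrightarrow> \<not> on_arc a b a" "a \<noteq> b \<Longrightarrow> \<not> on_arc a b b"
  by (auto simp: on_arc_def)

text \<open>Interlacement of two chords of the circle. As a formula it is asymmetric; symmetry holds
  once the four ends are distinct.\<close>

definition linked :: "real \<times> real \<Rightarrow> real \<times> real \<Rightarrow> bool" where
  "linked c g \<longleftrightarrow> on_arc (fst c) (snd c) (fst g) \<noteq> on_arc (fst c) (snd c) (snd g)"

text \<open>A sum of truth values can be split at an inserted element, reindexed along a bijection
  and compared termwise modulo 2. The predicate \<open>P\<close> lets one notion serve the affine
  index and the zero affine index.\<close>

definition link_parity ::
  "(real \<times> real) set \<Rightarrow> (real \<times> real \<Rightarrow> bool) \<Rightarrow> real \<times> real \<Rightarrow> bool" where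
  "link_parity X P c \<longleftrightarrow> odd (\<Sum>g\<in>X. of_bool (linked c g \<and> P g) :: nat)"

definition odd_crossing :: "(real \<times> real) set \<Rightarrow> real \<times> real \<Rightarrow> bool" where
  "odd_crossing X c \<longleftrightarrow> link_parity X (\<lambda>g. True) c"

text \<open>The exponent of \<open>s\<close> in the contribution of \<open>c\<close> to the \<open>Q\<^sup>z\<close>-polynomial, as a truth value.\<close>

definition zero_label :: "(real \<times> real) set \<Rightarrow> real \<times> real \<Rightarrow> bool" where
  "zero_label X c \<longleftrightarrow> odd_crossing X c \<or> link_parity X (\<lambda>g. \<not> odd_crossing X g) c"

definition bar_odd :: "real set \<Rightarrow> real \<Rightarrow> real \<Rightarrow> bool" where
  "bar_odd B a b \<longleftrightarrow> odd (\<Sum>t\<in>B. of_bool (on_arc a b t) :: nat)"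

lemma link_parity_empty [simp]: "\<not> link_parity {} P c"
  by (simp add: link_parity_def)

lemma link_parity_insert:
  "finite X \<Longrightarrow> h \<notin> X \<Longrightarrow>
    link_parity (insert h X) P c \<longleftrightarrow> (linked c h \<and> P h) \<noteq> link_parity X P c"
  by (cases "linked c h"; cases "P h") (simp_all add: link_parity_def del: sum_of_bool_eq)

lemma link_parity_cong:
  "(\<And>g. g \<in> X \<Longrightarrow> (linked c g \<and> P g) = (linked c' g \<and> P' g)) \<Longrightarrow>
    link_parity X P c = link_parity X P' c'"
  by (simp add: link_parity_def del: sum_of_bool_eq)

lemma bar_odd_insert:
  "finite B \<Longrightarrow> p \<notin> B \<Longrightarrow> bar_odd (insert p B) a b \<longleftrightarrow> on_arc a b p \<noteq> bar_odd B a b"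
  by (cases "on_arc a b p") (simp_all add: bar_odd_def del: sum_of_bool_eq)

lemma bar_odd_cong:
  "(\<And>t. t \<in> B \<Longrightarrow> on_arc a b t = on_arc a' b' t) \<Longrightarrow> bar_odd B a b = bar_odd B a' b'"
  by (simp add: bar_odd_def del: sum_of_bool_eq)

text \<open>A single exponent \<open>i\<close> serves both factors, because the two components of a
  smoothing have indices of the same parity. The product is symmetric in the ends of
  \<open>c\<close>, which matters for T3, where over and under are exchanged.\<close>

definition weight :: "real set \<Rightarrow> bool \<Rightarrow> real \<times> real \<Rightarrow> int poly poly" where
  "weight B i c =
     (var_s ^ of_bool i * var_t ^ of_bool (bar_odd B (fst c) (snd c)) - 1) *
     (var_s ^ of_bool i * var_t ^ of_bool (bar_odd B (snd c) (fst c)) - 1)"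

text \<open>The two polynomials differ only in the exponent of \<open>s\<close>; with the labelling
  as an argument each move treats both at once.\<close>

definition gauss_poly ::
  "((real \<times> real) set \<Rightarrow> real \<times> real \<Rightarrow> bool) \<Rightarrow>
   (real \<times> real) set \<Rightarrow> real set \<Rightarrow> (real \<times> real \<Rightarrow> int) \<Rightarrow> int poly poly" where
  "gauss_poly lab X B sg = (\<Sum>c\<in>X. of_int (sg c) * weight B (lab X c) c)"

lemma weight_cong:
  assumes "bar_odd B (fst c) (snd c) = bar_odd B' (fst c') (snd c')"
    and "bar_odd B (snd c) (fst c) = bar_odd B' (snd c') (fst c')"
  shows "weight B i c = weight B' i c'"
  using assms by (simp add: weight_def)

lemma weight_cong_swap:
  assumes "bar_odd B (fst c) (snd c) = bar_odd B' (snd c') (fst c')"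
    and "bar_odd B (snd c) (fst c) = bar_odd B' (fst c') (snd c')"
  shows "weight B i c = weight B' i c'"
  using assms by (simp add: weight_def mult.commute)

section \<open>The polynomials of a diagram in terms of its Gauss diagram\<close>

lemma crossings_double_points: "is_diagram D \<Longrightarrow> crossings D \<subseteq> double_points D"
  unfolding is_diagram_def by blast

lemma diagram_unit:
  assumes "is_diagram D" "c \<in> crossings D"
  shows "fst c \<in> {0..<1}" "snd c \<in> {0..<1}" "fst c \<noteq> snd c"
  using crossings_double_points[OF assms(1)] assms(2) by (auto simp: double_points_def)

lemma double_points_sym: "(t, u) \<in> double_points D \<Longrightarrow> (u, t) \<in> double_points D"
  by (auto simp: double_points_def)

lemma diagram_disjoint_ends:
  assumes D: "is_diagram D" and c: "c \<in> crossings D" and g: "g \<in> crossings D" and "c \<noteq> g"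
  shows "fst c \<noteq> fst g" "fst c \<noteq> snd g" "snd c \<noteq> fst g" "snd c \<noteq> snd g"
proof -
  have uniq: "\<And>t u v. (t, u) \<in> double_points D \<Longrightarrow> (t, v) \<in> double_points D \<Longrightarrow> u = v"
    and sub: "crossings D \<subseteq> double_points D" and anti: "crossings D \<inter> (crossings D)\<inverse> = {}"
    using D unfolding is_diagram_def by blast+
  obtain x y u v where e: "c = (x, y)" "g = (u, v)" by fastforce
  have d: "(x, y) \<in> double_points D" "(y, x) \<in> double_points D"
    "(u, v) \<in> double_points D" "(v, u) \<in> double_points D"
    using c g sub e double_points_sym by blast+
  \<comment> \<open>A double point has only one partner, so sharing an end forces \<open>g\<close>
    to be \<open>c\<close> or \<open>c\<close> with over and under exchanged; antisymmetry of the
    crossing set excludes the latter.\<close>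
  have "(v, u) \<noteq> (x, y)" using c g anti e by auto
  then show "fst c \<noteq> fst g" "fst c \<noteq> snd g" "snd c \<noteq> fst g" "snd c \<noteq> snd g"
    using uniq d e \<open>c \<noteq> g\<close> by auto
qed

lemma diagram_finite_crossings: "is_diagram D \<Longrightarrow> finite (crossings D)"
  unfolding is_diagram_def using finite_subset by blast

lemma on_arc_linked_sym:
  assumes "x \<noteq> y" "u \<noteq> v" "x \<noteq> u" "x \<noteq> v" "y \<noteq> u" "y \<noteq> v"
  shows "(on_arc x y u \<noteq> on_arc x y v) \<longleftrightarrow> (on_arc u v x \<noteq> on_arc u v y)"
  using assms unfolding on_arc_iff by argo

lemma linked_sym:
  assumes D: "is_diagram D" and "c \<in> crossings D" and "g \<in> crossings D"
  shows "linked c g \<longleftrightarrow> linked g c"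
proof (cases "c = g")
  case False
  then show ?thesis
    unfolding linked_def
    using diagram_disjoint_ends[OF assms] diagram_unit(3)[OF D assms(2)] diagram_unit(3)[OF D assms(3)]
    by (intro on_arc_linked_sym) auto
qed simp

lemma odd_sum_cong:
  fixes f g :: "'a \<Rightarrow> nat"
  assumes "finite A" "\<And>a. a \<in> A \<Longrightarrow> odd (f a) \<longleftrightarrow> odd (g a)"
  shows "odd (sum f A) \<longleftrightarrow> odd (sum g A)"
  using assms by (induction A rule: finite_induct) auto

lemma odd_sum_signs:
  fixes f :: "'a \<Rightarrow> int"
  assumes "finite A" "\<And>a. a \<in> A \<Longrightarrow> odd (f a)"
  shows "even (sum f A) \<longleftrightarrow> even (card A)"
  using assms by (induction A rule: finite_induct) auto

text \<open>Modulo 2 signs disappear and every passage counts 1. A crossing met twice by the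
  component cancels, and one met exactly once has its two ends on different components, which is
  linking. The set \<open>Y\<close> is later all crossings for the index and the zero crossings for
  the zero index.\<close>

lemma even_passages:
  assumes D: "is_diagram D" and c: "c \<in> crossings D" and l: "l \<in> {0, 1}" and Y: "Y \<subseteq> crossings D"
  shows "even (\<Sum>(g, e)\<in>{(g, e) \<in> passages D l c. g \<in> Y}. (-1) ^ e * crossing_sign D g)
    \<longleftrightarrow> even (\<Sum>g\<in>Y. of_bool (linked c g) :: nat)"
proof -
  let ?S = "smoothing_component l c"
  let ?O = "{g \<in> Y. fst g \<in> ?S}" and ?U = "{g \<in> Y. snd g \<in> ?S}"
  have fY: "finite Y" using diagram_finite_crossings[OF D] Y finite_subset by blast
  have split: "{(g, e) \<in> passages D l c. g \<in> Y} = ?O \<times> {1} \<union> ?U \<times> {0}"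
    using Y by (auto simp: passages_def)
  \<comment> \<open>For \<open>l = 1\<close> the component is the complementary arc, which negates
    both memberships and keeps their difference. The ends of \<open>c\<close> itself lie on neither
    open arc, in accordance with \<open>c\<close> not being linked with itself.\<close>
  have cut: "(fst g \<in> ?S) \<noteq> (snd g \<in> ?S) \<longleftrightarrow> linked c g" if g: "g \<in> Y" for g
  proof -
    have gX: "g \<in> crossings D" using g Y by blast
    note u = diagram_unit(1,2)[OF D gX] diagram_unit(3)[OF D c]
    show ?thesis
    proof (cases "g = c")
      case True
      then show ?thesis using u l
        by (auto simp: linked_def smoothing_component_def mem_circle_arc)
    next
      case False
      then show ?thesis using u l diagram_disjoint_ends[OF D c gX]
        by (auto simp: linked_def smoothing_component_def mem_circle_arc
            on_arc_swap[of "fst c" "snd c"])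
    qed
  qed
  have "even (\<Sum>(g, e)\<in>?O \<times> {1} \<union> ?U \<times> {0}. (-1) ^ e * crossing_sign D g)
    \<longleftrightarrow> even (card (?O \<times> {1::nat} \<union> ?U \<times> {0::nat}))"
    using fY by (intro odd_sum_signs) (auto simp: crossing_sign_def split: if_splits)
  also have "card (?O \<times> {1::nat} \<union> ?U \<times> {0::nat}) = card ?O + card ?U"
    using fY by (subst card_Un_disjoint) auto
  also have "\<dots> = (\<Sum>g\<in>Y. of_bool (fst g \<in> ?S) + of_bool (snd g \<in> ?S))"
    using fY by (simp add: sum.distrib Int_def conj_commute)
  also have "even \<dots> \<longleftrightarrow> even (\<Sum>g\<in>Y. of_bool (linked c g) :: nat)"
  proof -
    have "odd (\<Sum>g\<in>Y. of_bool (fst g \<in> ?S) + of_bool (snd g \<in> ?S) :: nat)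
      \<longleftrightarrow> odd (\<Sum>g\<in>Y. of_bool (linked c g) :: nat)"
      by (rule odd_sum_cong[OF fY]) (simp add: cut[symmetric])
    then show ?thesis by blast
  qed
  finally show ?thesis unfolding split .
qed

lemma nat_mod_2: "nat (k mod 2) = of_bool (odd k)" for k :: int
  by (simp add: mod_2_eq_odd)

lemma ind_parity_eq:
  assumes "is_diagram D" "c \<in> crossings D" "l \<in> {0, 1}"
  shows "ind_parity D l c = of_bool (odd_crossing (crossings D) c)"
proof -
  have "{(g, e) \<in> passages D l c. g \<in> crossings D} = passages D l c"
    by (auto simp: passages_def)
  then show ?thesis using even_passages[OF assms order.refl]
    by (simp add: ind_parity_def nat_mod_2 affine_ind_def odd_crossing_def link_parity_def)
qed

lemma zero_crossings_eq:
  assumes "is_diagram D"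
  shows "zero_crossings D = {c \<in> crossings D. \<not> odd_crossing (crossings D) c}"
proof -
  have "even (affine_ind D l c) \<longleftrightarrow> \<not> odd_crossing (crossings D) c"
    if "c \<in> crossings D" "l \<in> {0, 1}" for l c
    using ind_parity_eq[OF assms that]
    by (auto simp add: ind_parity_def nat_mod_2)
  then show ?thesis unfolding zero_crossings_def by blast
qed

lemma zero_parity_eq:
  assumes D: "is_diagram D" and c: "c \<in> zero_crossings D"
  shows "zero_parity D c = of_bool (zero_label (crossings D) c)"
proof -
  let ?X = "crossings D"
  have cX: "c \<in> ?X" and nc: "\<not> odd_crossing ?X c" using c zero_crossings_eq[OF D] by auto
  have fin: "finite ?X" by (rule diagram_finite_crossings[OF D])
  have "even (zero_affine_ind D 0 c) \<longleftrightarrow> even (\<Sum>g\<in>zero_crossings D. of_bool (linked c g) :: nat)"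
    unfolding zero_affine_ind_def
    by (rule even_passages[OF D cX]) (auto simp: zero_crossings_def)
  also have "(\<Sum>g\<in>zero_crossings D. of_bool (linked c g) :: nat)
    = (\<Sum>g\<in>?X. if \<not> odd_crossing ?X g then of_bool (linked c g) else 0)"
    unfolding zero_crossings_eq[OF D] using fin by (rule sum.inter_filter)
  also have "\<dots> = (\<Sum>g\<in>?X. of_bool (linked c g \<and> \<not> odd_crossing ?X g))"
    by (rule sum.cong) auto
  finally show ?thesis
    using nc by (simp add: zero_parity_def nat_mod_2 zero_label_def link_parity_def)
qed

lemma bar_parity_eq:
  assumes D: "is_diagram D"
  shows "bar_parity D 0 c = of_bool (bar_odd (bars D) (fst c) (snd c))"
    and "bar_parity D 1 c = of_bool (bar_odd (bars D) (snd c) (fst c))"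
proof -
  have B: "finite (bars D)" "bars D \<subseteq> {0..<1}" using D by (auto simp: is_diagram_def)
  have "bars D \<inter> circle_arc a b = {t \<in> bars D. on_arc a b t}" for a b
    using B mem_circle_arc by blast
  then show "bar_parity D 0 c = of_bool (bar_odd (bars D) (fst c) (snd c))"
    and "bar_parity D 1 c = of_bool (bar_odd (bars D) (snd c) (fst c))"
    using B by (simp_all add: bar_parity_def bar_odd_def mod_2_eq_odd smoothing_component_def Int_def)
qed

lemma weight_bar_parity:
  assumes "is_diagram D"
  shows "weight (bars D) i c =
    (var_s ^ of_bool i * var_t ^ bar_parity D 0 c - 1) *
    (var_s ^ of_bool i * var_t ^ bar_parity D 1 c - 1)"
  by (simp only: weight_def bar_parity_eq[OF assms])

lemma Q_poly_eq:
  assumes D: "is_diagram D"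
  shows "Q_poly D = gauss_poly odd_crossing (crossings D) (bars D) (crossing_sign D)"
  unfolding Q_poly_def gauss_poly_def weight_bar_parity[OF D]
  by (rule sum.cong[OF refl])
    (simp only: ind_parity_eq[OF D] mult.assoc insert_iff simp_thms)

lemma Qz_poly_eq:
  assumes D: "is_diagram D"
  shows "Qz_poly D = gauss_poly zero_label (crossings D) (bars D) (crossing_sign D)"
proof -
  let ?X = "crossings D" and ?Z = "zero_crossings D"
  let ?f = "\<lambda>c. of_int (crossing_sign D c) * weight (bars D) (zero_label ?X c) c"
  have "sum ?f ?X = sum ?f (?X - ?Z) + sum ?f ?Z"
    by (rule sum.subset_diff) (auto simp: zero_crossings_def diagram_finite_crossings[OF D])
  moreover have "sum ?f (?X - ?Z) = (\<Sum>c\<in>?X - ?Z. of_int (crossing_sign D c) *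
        (var_s * var_t ^ bar_parity D 0 c - 1) * (var_s * var_t ^ bar_parity D 1 c - 1))"
  proof (rule sum.cong[OF refl])
    fix c assume "c \<in> ?X - ?Z"
    \<comment> \<open>Odd crossings carry the fixed exponent 1, so the second sum of the polynomial
      is the first one with label true, and the two sums merge.\<close>
    then have "zero_label ?X c" by (auto simp: zero_crossings_eq[OF D] zero_label_def)
    then show "?f c = of_int (crossing_sign D c) *
        (var_s * var_t ^ bar_parity D 0 c - 1) * (var_s * var_t ^ bar_parity D 1 c - 1)"
      by (simp only: weight_bar_parity[OF D] mult.assoc of_bool_eq power_one_right)
  qed
  moreover have "sum ?f ?Z = (\<Sum>c\<in>?Z. of_int (crossing_sign D c) *
        (var_s ^ zero_parity D c * var_t ^ bar_parity D 0 c - 1) *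
        (var_s ^ zero_parity D c * var_t ^ bar_parity D 1 c - 1))"
    by (rule sum.cong[OF refl])
      (simp only: zero_parity_eq[OF D] weight_bar_parity[OF D] mult.assoc)
  ultimately show ?thesis by (simp only: Qz_poly_def gauss_poly_def add.commute)
qed

section \<open>Transport of both polynomials along a bijection of crossings\<close>

definition same_polys :: "diagram \<Rightarrow> diagram \<Rightarrow> bool" where
  "same_polys D D' \<longleftrightarrow> Q_poly D = Q_poly D' \<and> Qz_poly D = Qz_poly D'"

lemma gauss_poly_bij:
  assumes "bij_betw \<phi> X X'"
    and "\<And>c. c \<in> X \<Longrightarrow> lab X' (\<phi> c) = lab X c"
    and "\<And>c. c \<in> X \<Longrightarrow> sg' (\<phi> c) = sg c"
    and "\<And>c i. c \<in> X \<Longrightarrow> weight B' i (\<phi> c) = weight B i c"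
  shows "gauss_poly lab X B sg = gauss_poly lab X' B' sg'"
  unfolding gauss_poly_def sum.reindex_bij_betw[OF assms(1), symmetric]
  by (rule sum.cong) (simp_all add: assms)

text \<open>Both labellings are computed from linking alone, so a bijection preserving linking
  preserves labels. Weights are compared instead of bar parities of single arcs, since a bijection
  may exchange the two ends of a crossing.\<close>

lemma gauss_poly_iso:
  assumes bij: "bij_betw \<phi> X X'"
    and lk: "\<And>c g. c \<in> X \<Longrightarrow> g \<in> X \<Longrightarrow> linked (\<phi> c) (\<phi> g) = linked c g"
    and sg: "\<And>c. c \<in> X \<Longrightarrow> sg' (\<phi> c) = sg c"
    and w: "\<And>c i. c \<in> X \<Longrightarrow> weight B' i (\<phi> c) = weight B i c"
  shows "gauss_poly odd_crossing X B sg = gauss_poly odd_crossing X' B' sg'"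
    and "gauss_poly zero_label X B sg = gauss_poly zero_label X' B' sg'"
proof -
  have lp: "link_parity X' P (\<phi> c) = link_parity X (P \<circ> \<phi>) c" if "c \<in> X" for P c
    unfolding link_parity_def sum.reindex_bij_betw[OF bij, symmetric]
    using lk that by (simp del: sum_of_bool_eq)
  have o: "odd_crossing X' (\<phi> c) = odd_crossing X c" if "c \<in> X" for c
    using lp[OF that] by (simp add: odd_crossing_def o_def)
  have z: "zero_label X' (\<phi> c) = zero_label X c" if "c \<in> X" for c
    unfolding zero_label_def lp[OF that] o[OF that]
    by (rule arg_cong[of _ _ "\<lambda>b. _ \<or> b"], rule link_parity_cong) (auto simp: o)
  show "gauss_poly odd_crossing X B sg = gauss_poly odd_crossing X' B' sg'"
    and "gauss_poly zero_label X B sg = gauss_poly zero_label X' B' sg'"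
    using o z by (auto intro!: gauss_poly_bij[OF bij] sg w)
qed

lemma same_polys_iso:
  assumes "is_diagram D" "is_diagram D'"
    and "bij_betw \<phi> (crossings D) (crossings D')"
    and "\<And>c g. c \<in> crossings D \<Longrightarrow> g \<in> crossings D \<Longrightarrow> linked (\<phi> c) (\<phi> g) = linked c g"
    and "\<And>c. c \<in> crossings D \<Longrightarrow> crossing_sign D' (\<phi> c) = crossing_sign D c"
    and "\<And>c i. c \<in> crossings D \<Longrightarrow> weight (bars D') i (\<phi> c) = weight (bars D) i c"
  shows "same_polys D D'"
  unfolding same_polys_def Q_poly_eq[OF assms(1)] Q_poly_eq[OF assms(2)]
    Qz_poly_eq[OF assms(1)] Qz_poly_eq[OF assms(2)]
  using assms(3-6) by (auto intro!: gauss_poly_iso[of \<phi>])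


section \<open>Planar isotopy\<close>

lemma curve_has_tangent:
  assumes "is_diagram D"
  shows "(curve D has_vector_derivative tangent D t) (at t)"
  using assms unfolding is_diagram_def tangent_def C1_differentiable_on_eq
  by (auto intro: vector_derivative_works[THEN iffD1])

lemma curve_periodic:
  assumes "is_diagram D"
  shows "curve D (t + of_int n) = curve D t"
proof -
  have p: "curve D (t + 1) = curve D t" for t using assms by (auto simp: is_diagram_def)
  have nat: "curve D (t + of_nat k) = curve D t" for t k
    using p[of "t + of_nat k" for k] by (induction k) (auto simp: add.assoc[symmetric] add.commute[of 1])
  show ?thesis
  proof (cases n)
    case (nonneg k)
    then show ?thesis using nat[of t k] by simp
  next
    case (neg k)
    then show ?thesis using nat[of "t + of_int n" "Suc k"] by simp
  qed
qed

lemma tangent_periodic: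
  assumes D: "is_diagram D"
  shows "tangent D (t + of_int n) = tangent D t"
proof -
  have "((\<lambda>x. x + of_int n) has_vector_derivative 1) (at t)"
    by (auto intro!: derivative_eq_intros)
  from vector_diff_chain_at[OF this curve_has_tangent[OF D]]
  have "(curve D has_vector_derivative tangent D (t + of_int n)) (at t)"
    by (simp add: o_def curve_periodic[OF D])
  then show ?thesis using curve_has_tangent[OF D] vector_derivative_unique_at by blast
qed

lemma tangent_frac: "is_diagram D \<Longrightarrow> tangent D (frac t) = tangent D t"
  using tangent_periodic[of D t "- \<lfloor>t\<rfloor>"] by (simp add: frac_def)

lemma plane_det_scaleR: "plane_det (a *\<^sub>R v) (b *\<^sub>R w) = a * b * plane_det v w"
  by (simp add: plane_det_def algebra_simps)

lemma plane_det_linear: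
  assumes "linear A"
  shows "plane_det (A v) (A w) = plane_det (A 1) (A \<i>) * plane_det v w"
proof -
  have e: "A z = Re z *\<^sub>R A 1 + Im z *\<^sub>R A \<i>" for z
  proof -
    have "z = Re z *\<^sub>R 1 + Im z *\<^sub>R \<i>" by (simp add: complex_eq_iff)
    then have "A z = A (Re z *\<^sub>R 1 + Im z *\<^sub>R \<i>)" by simp
    then show ?thesis by (simp only: linear_add[OF assms] linear_scale[OF assms])
  qed
  show ?thesis unfolding e[of v] e[of w] plane_det_def by (simp add: algebra_simps)
qed

lemma plane_det_bij_neq_0:
  assumes "linear A" "bij A"
  shows "plane_det (A 1) (A \<i>) \<noteq> 0"
proof
  assume "plane_det (A 1) (A \<i>) = 0"
  then have "plane_det (A v) (A w) = 0" for v w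
    unfolding plane_det_linear[OF assms(1), of v w] by simp
  moreover obtain v w where "A v = 1" "A w = \<i>" using bij_is_surj[OF assms(2)] by (metis surjD)
  ultimately have "plane_det 1 \<i> = 0" by metis
  then show False by (simp add: plane_det_def)
qed

text \<open>The Jacobian determinant at a fixed point depends continuously on the time
  \<open>s\<close>, never vanishes, and equals 1 at time 0, where the map is the identity. By the
  intermediate value theorem it remains positive.\<close>

lemma ambient_isotopy_orientation:
  assumes "ambient_isotopy H"
  obtains A where "\<And>z. (H 1 has_derivative A z) (at z)" "\<And>z. plane_det (A z 1) (A z \<i>) > 0"
proof -
  obtain H' where
    der: "\<And>s z. s \<in> {0..1} \<Longrightarrow> (H s has_derivative H' s z) (at z)" and
    bij: "\<And>s z. s \<in> {0..1} \<Longrightarrow> bij (H' s z)" and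
    cont: "\<And>v. continuous_on ({0..1} \<times> UNIV) (\<lambda>(s, z). H' s z v)" and
    zero: "\<And>z. H 0 z = z"
    using assms unfolding ambient_isotopy_def by blast
  have "plane_det (H' 1 z 1) (H' 1 z \<i>) > 0" for z
  proof (rule ccontr)
    let ?d = "\<lambda>s. plane_det (H' s z 1) (H' s z \<i>)"
    assume "\<not> ?d 1 > 0"
    have c: "continuous_on {0..1} (\<lambda>s. H' s z v)" for v
    proof -
      have "continuous_on {0..1} ((\<lambda>(s, z). H' s z v) \<circ> (\<lambda>s. (s, z)))"
        by (rule continuous_on_compose)
          (auto intro!: continuous_intros intro: continuous_on_subset[OF cont])
      then show ?thesis by (simp add: o_def)
    qed
    have "continuous_on {0..1} ?d"
      unfolding plane_det_def by (intro continuous_intros c)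
    moreover have "?d 0 = 1"
    proof -
      have "H 0 = (\<lambda>z. z)" using zero by blast
      moreover have "(H 0 has_derivative H' 0 z) (at z)" by (rule der) simp
      ultimately have "((\<lambda>z. z) has_derivative H' 0 z) (at z)" by simp
      then have "H' 0 z = (\<lambda>z. z)" using has_derivative_ident by (rule has_derivative_unique)
      then show ?thesis by (simp add: plane_det_def)
    qed
    ultimately obtain s where "s \<in> {0..1}" "?d s = 0"
      using IVT2'[of ?d 1 0 0] \<open>\<not> ?d 1 > 0\<close> by auto
    then show False
      using plane_det_bij_neq_0[of "H' s z"] bij has_derivative_linear[OF der] by blast
  qed
  then show thesis using der that[of "H' 1"] by simp
qed

text \<open>On a window of length 1 the map \<open>frac\<close> cuts at the single integer
  \<open>m + 1\<close> and exchanges the two pieces in order. This is a rotation of the circle, and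
  rotations preserve cyclic arcs.\<close>

lemma frac_arc:
  assumes "t \<in> {F..<F + 1}" "a \<in> {F..<F + 1}" "b \<in> {F..<F + 1}"
  shows "on_arc (frac a) (frac b) (frac t) \<longleftrightarrow> on_arc a b t"
proof -
  define m where "m = real_of_int \<lfloor>F\<rfloor>"
  have m: "m \<le> F" "F < m + 1" unfolding m_def by linarith+
  have fr: "v < m + 1 \<and> frac v = v - m \<or> m + 1 \<le> v \<and> frac v = v - m - 1"
    if "v \<in> {F..<F + 1}" for v
  proof (cases "v < m + 1")
    case True
    then have "\<lfloor>v\<rfloor> = \<lfloor>F\<rfloor>"
      using that m unfolding m_def atLeastLessThan_iff by (intro floor_unique) linarith+
    then show ?thesis using True by (simp add: frac_def m_def)
  next
    case False
    then have "\<lfloor>v\<rfloor> = \<lfloor>F\<rfloor> + 1"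
      using that m unfolding m_def atLeastLessThan_iff by (intro floor_unique) linarith+
    then show ?thesis using False by (simp add: frac_def m_def)
  qed
  show ?thesis
    using fr[OF assms(1)] fr[OF assms(2)] fr[OF assms(3)] m assms unfolding on_arc_iff atLeastLessThan_iff
    by argo
qed

lemma reparametrization_strict_mono:
  assumes "reparametrization f"
  shows "strict_mono f"
proof (rule strict_monoI)
  fix x y :: real assume "x < y"
  have "(f has_real_derivative vector_derivative f (at t)) (at t)" for t
    using assms unfolding reparametrization_def C1_differentiable_on_eq
    by (auto simp: has_real_derivative_iff_has_vector_derivative intro: vector_derivative_works[THEN iffD1])
  moreover have "vector_derivative f (at t) > 0" for t
    using assms unfolding reparametrization_def by blast
  ultimately show "f x < f y" by (intro DERIV_pos_imp_increasing[OF \<open>x < y\<close>]) blast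
qed

lemma reparametrization_range:
  assumes f: "reparametrization f" and t: "t \<in> {0..<1}"
  shows "f t \<in> {f 0..<f 0 + 1}"
proof -
  have "f (0 + 1) = f 0 + 1" using f unfolding reparametrization_def by blast
  then show ?thesis
    using t strict_mono_less_eq[OF reparametrization_strict_mono[OF f], of 0 t]
      strict_mono_less[OF reparametrization_strict_mono[OF f], of t 1] by auto
qed

lemma reparametrization_frac_bij:
  assumes f: "reparametrization f"
  shows "bij_betw (\<lambda>t. frac (f t)) {0..<1} {0..<1}"
proof (rule bij_betw_imageI)
  note sm = reparametrization_strict_mono[OF f]
  show "inj_on (\<lambda>t. frac (f t)) {0..<1}"
  proof (rule inj_onI)
    fix t u :: real assume tu: "t \<in> {0..<1}" "u \<in> {0..<1}" and e: "frac (f t) = frac (f u)"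
    obtain k where k: "f t - f u = of_int k"
      using e unfolding frac_def by (metis add_diff_cancel_left' diff_add_eq diff_diff_eq2 of_int_diff)
    have "\<bar>f t - f u\<bar> < 1" 
      using reparametrization_range[OF f tu(1)] reparametrization_range[OF f tu(2)]
      unfolding atLeastLessThan_iff by linarith
    then have "k = 0" using k by linarith
    then show "t = u" using k strict_mono_eq[OF sm] by auto
  qed
  show "(\<lambda>t. frac (f t)) ` {0..<1} = {0..<1}"
  proof (intro equalityI subsetI)
    fix y :: real assume y: "y \<in> {0..<1}"
    \<comment> \<open>The integer translate of \<open>y\<close> in the window covered by
      \<open>f\<close>; it is attained on the closed unit interval because
      \<open>f 1 = f 0 + 1\<close>, and not at 1 because the window is half open.\<close>
    define v where "v = y + of_int \<lceil>f 0 - y\<rceil>"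
    have v: "v \<in> {f 0..<f 0 + 1}" unfolding v_def by (auto; linarith)
    have one: "f 1 = f 0 + 1" using f unfolding reparametrization_def by (metis add_0)
    have "f C1_differentiable_on UNIV" using f unfolding reparametrization_def by blast
    then have "continuous_on {0..1} f"
      using C1_differentiable_imp_continuous_on continuous_on_subset by blast
    then obtain t where t: "0 \<le> t" "t \<le> 1" "f t = v"
      using IVT'[of f 0 v 1] v one by auto
    have "t \<noteq> 1" using t v one by auto
    moreover have "frac v = y"
      using y unfolding v_def by (simp add: frac_eq[THEN iffD2])
    ultimately show "y \<in> (\<lambda>t. frac (f t)) ` {0..<1}" using t by force
  qed (auto simp: frac_lt_1)
qed

lemma zero_less_mult_pos_iff: "0 < a \<Longrightarrow> 0 < a * b \<longleftrightarrow> 0 < b" for a b :: real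
  by (simp add: zero_less_mult_iff)

text \<open>By the chain rule each tangent is transformed by the derivative of the final
  diffeomorphism and scaled by the derivative of \<open>f\<close>. The determinant of the two
  tangents thus gets three positive factors.\<close>

lemma planar_isotopic_crossing_sign:
  assumes D: "is_diagram D" and D': "is_diagram D'"
    and H: "ambient_isotopy H" and f: "reparametrization f"
    and curve: "\<And>t. curve D' t = H 1 (curve D (f t))"
    and c: "(t, u) \<in> crossings D'"
  shows "crossing_sign D' (t, u) = crossing_sign D (frac (f t), frac (f u))"
proof -
  obtain A where A: "\<And>z. (H 1 has_derivative A z) (at z)"
    "\<And>z. plane_det (A z 1) (A z \<i>) > 0"
    using ambient_isotopy_orientation[OF H] by blast
  have A_lin: "linear (A z)" for z using A(1) has_derivative_linear by blast
  define g where "g = (\<lambda>t. vector_derivative f (at t))"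
  have g: "(f has_vector_derivative g t) (at t)" "g t > 0" for t
    using f unfolding reparametrization_def C1_differentiable_on_eq g_def
    by (auto intro: vector_derivative_works[THEN iffD1])
  have curve_eq: "H 1 \<circ> (curve D \<circ> f) = curve D'" using curve by auto
  have tan: "tangent D' t = g t *\<^sub>R A (curve D (f t)) (tangent D (frac (f t)))" for t
  proof -
    have "(curve D \<circ> f has_vector_derivative g t *\<^sub>R tangent D (f t)) (at t)"
      by (rule vector_diff_chain_at[OF g(1) curve_has_tangent[OF D]])
    then have "((H 1 \<circ> (curve D \<circ> f)) has_derivative
      (A (curve D (f t)) \<circ> (\<lambda>x. x *\<^sub>R g t *\<^sub>R tangent D (f t)))) (at t)"
      unfolding has_vector_derivative_def
      by (rule diff_chain_at) (use A(1) in \<open>simp add: o_def\<close>)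
    then have "(curve D' has_vector_derivative g t *\<^sub>R A (curve D (f t)) (tangent D (f t))) (at t)"
      unfolding curve_eq[symmetric] has_vector_derivative_def
      by (simp add: o_def linear_scale[OF A_lin])
    then show ?thesis
      using vector_derivative_unique_at[OF curve_has_tangent[OF D']] by (simp add: tangent_frac[OF D])
  qed
  have "curve D' t = curve D' u"
    using c crossings_double_points[OF D'] by (auto simp: double_points_def)
  \<comment> \<open>Injectivity turns the double point of \<open>D'\<close> into one of
    \<open>D\<close>, so that the same derivative acts on both strands.\<close>
  moreover have "inj (H 1)" using H unfolding ambient_isotopy_def by (meson atLeastAtMost_iff bij_is_inj order.refl zero_le_one)
  ultimately have z: "curve D (f t) = curve D (f u)" unfolding curve by (metis injD)
  have "plane_det (tangent D' t) (tangent D' u)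
    = g t * g u * (plane_det (A (curve D (f u)) 1) (A (curve D (f u)) \<i>)
       * plane_det (tangent D (frac (f t))) (tangent D (frac (f u))))"
    unfolding tan z plane_det_scaleR
      plane_det_linear[OF A_lin, of _ "tangent D (frac (f t))" "tangent D (frac (f u))"] by simp
  then have "plane_det (tangent D' t) (tangent D' u) > 0
    \<longleftrightarrow> plane_det (tangent D (frac (f t))) (tangent D (frac (f u))) > 0"
    using g(2) A(2) by (simp only: zero_less_mult_pos_iff mult_pos_pos)
  then show ?thesis by (simp add: crossing_sign_def)
qed

lemma planar_isotopic_same_polys:
  assumes D: "is_diagram D" and D': "is_diagram D'" and iso: "planar_isotopic D D'"
  shows "same_polys D D'"
proof -
  obtain H f where H: "ambient_isotopy H" and f: "reparametrization f"
    and curve: "\<And>t. curve D' t = H 1 (curve D (f t))"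
    and X': "crossings D' = {(t, u). t \<in> {0..<1} \<and> u \<in> {0..<1} \<and> (frac (f t), frac (f u)) \<in> crossings D}"
    and B': "bars D' = {t \<in> {0..<1}. frac (f t) \<in> bars D}"
    using iso unfolding planar_isotopic_def by blast
  define \<phi> where "\<phi> = (\<lambda>t. frac (f t))"
  have bij: "bij_betw \<phi> {0..<1} {0..<1}"
    unfolding \<phi>_def by (rule reparametrization_frac_bij[OF f])
  have on_arc: "on_arc (\<phi> a) (\<phi> b) (\<phi> t) = on_arc a b t"
    if "a \<in> {0..<1}" "b \<in> {0..<1}" "t \<in> {0..<1}" for a b t
  proof -
    have "on_arc (\<phi> a) (\<phi> b) (\<phi> t) = on_arc (f a) (f b) (f t)"
      unfolding \<phi>_def by (rule frac_arc) (use that reparametrization_range[OF f] in blast)+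
    also have "\<dots> = on_arc a b t"
      unfolding on_arc_def strict_mono_less[OF reparametrization_strict_mono[OF f]] ..
    finally show ?thesis .
  qed
  have inj: "inj_on \<phi> {0..<1}" and surj: "\<phi> ` {0..<1} = {0..<1}"
    using bij by (auto simp: bij_betw_def)
  have bb: "bij_betw \<phi> (bars D') (bars D)"
  proof (rule bij_betw_imageI)
    show "inj_on \<phi> (bars D')" using inj by (rule inj_on_subset) (auto simp: B')
    have "bars D \<subseteq> {0..<1}" using D by (auto simp: is_diagram_def)
    then have "bars D \<subseteq> \<phi> ` {0..<1}" using surj by simp
    then show "\<phi> ` bars D' = bars D" unfolding B' \<phi>_def by blast
  qed
  have bc: "bar_odd (bars D) (\<phi> a) (\<phi> b) = bar_odd (bars D') a b"
    if "a \<in> {0..<1}" "b \<in> {0..<1}" for a b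
    unfolding bar_odd_def sum.reindex_bij_betw[OF bb, symmetric]
    by (rule arg_cong[of _ _ odd], rule sum.cong) (use that in \<open>auto simp: on_arc B'\<close>)
  let ?\<Phi> = "map_prod \<phi> \<phi>"
  note unit = diagram_unit(1,2)[OF D']
  \<comment> \<open>Planar isotopy describes crossings and bars of \<open>D'\<close> as preimages of
    those of \<open>D\<close>; hence the bijection runs from \<open>D'\<close> to
    \<open>D\<close>.\<close>
  have "same_polys D' D"
  proof (rule same_polys_iso[OF D' D, of ?\<Phi>])
    show "bij_betw ?\<Phi> (crossings D') (crossings D)"
    proof (rule bij_betw_imageI)
      show "inj_on ?\<Phi> (crossings D')"
        by (rule inj_on_subset[OF map_prod_inj_on[OF inj inj]]) (auto simp: X')
      have "crossings D \<subseteq> {0..<1} \<times> {0..<1}"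
        using diagram_unit[OF D] by (auto simp: mem_Times_iff)
      also have "\<dots> = ?\<Phi> ` ({0..<1} \<times> {0..<1})"
        using surj by (simp add: map_prod_surj_on)
      finally show "?\<Phi> ` crossings D' = crossings D" unfolding X' \<phi>_def by fastforce
    qed
    show "crossing_sign D (?\<Phi> c) = crossing_sign D' c" if "c \<in> crossings D'" for c
      using planar_isotopic_crossing_sign[OF D D' H f curve, of "fst c" "snd c"] that
      by (simp add: \<phi>_def map_prod_def split_beta)
    show "linked (?\<Phi> c) (?\<Phi> g) = linked c g" if "c \<in> crossings D'" "g \<in> crossings D'" for c g
      unfolding linked_def fst_map_prod snd_map_prod
      using unit[OF that(1)] unit[OF that(2)] by (simp only: on_arc)
    show "weight (bars D) i (?\<Phi> c) = weight (bars D') i c" if "c \<in> crossings D'" for c i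
      using unit[OF that] by (intro weight_cong) (simp_all only: bc fst_map_prod snd_map_prod)
  qed
  then show ?thesis by (simp add: same_polys_def)
qed


section \<open>Reidemeister moves\<close>

lemma on_arc_same_strand:
  assumes "x \<in> strand s" "y \<in> strand s" "u \<notin> strand s"
  shows "on_arc x u y \<longleftrightarrow> x < y" "on_arc u x y \<longleftrightarrow> y < x" "on_arc x y u \<longleftrightarrow> \<not> x < y"
  using assms unfolding strand_def greaterThanLessThan_iff on_arc_iff by argo+

text \<open>Strands are intervals, so points outside a strand do not separate points inside it. The
  exact position on a strand is therefore invisible from outside.\<close>

lemma on_arc_slide:
  assumes "x \<in> strand s" "y \<in> strand s" "u \<notin> strand s" "v \<notin> strand s"
  shows "on_arc x u v \<longleftrightarrow> on_arc y u v" "on_arc u x v \<longleftrightarrow> on_arc u y v" "on_arc u v x \<longleftrightarrow> on_arc u v y"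
  using assms unfolding strand_def greaterThanLessThan_iff on_arc_iff by argo+

text \<open>If \<open>b\<close> lies between \<open>a\<close> and \<open>c\<close> in cyclic order,
  the arcs from \<open>a\<close> to \<open>b\<close> and from \<open>b\<close> to \<open>c\<close>
  together make up the arc from \<open>a\<close> to \<open>c\<close>, and the sum modulo 2 is 0
  everywhere. In the other cyclic order it is 1 everywhere.\<close>

lemma on_arc_triangle:
  assumes "a \<noteq> b" "a \<noteq> c" "b \<noteq> c" "u \<notin> {a, b, c}" "v \<notin> {a, b, c}"
  shows "(on_arc a b u \<noteq> (on_arc a c u \<noteq> on_arc b c u)) \<longleftrightarrow> (on_arc a b v \<noteq> (on_arc a c v \<noteq> on_arc b c v))"
  using assms unfolding on_arc_iff insert_iff empty_iff by argo

lemma not_linked_self: "fst c \<noteq> snd c \<Longrightarrow> \<not> linked c c"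
  by (simp add: linked_def)

section \<open>Adding and exchanging crossings of a Gauss diagram\<close>

lemma gauss_poly_cong:
  assumes "\<And>c. c \<in> X \<Longrightarrow> lab' c = lab X c" "\<And>c. c \<in> X \<Longrightarrow> sg' c = sg c"
  shows "(\<Sum>c\<in>X. of_int (sg' c) * weight B (lab' c) c) = gauss_poly lab X B sg"
  unfolding gauss_poly_def by (rule sum.cong) (simp_all add: assms)

text \<open>An isolated chord has label false under both labellings and changes no other label, so
  its only contribution is its weight at label false. This is the kink of C1.\<close>

lemma gauss_poly_add_isolated:
  assumes fin: "finite X" and d: "d \<notin> X" "\<not> linked d d"
    and l: "\<And>c. c \<in> X \<Longrightarrow> \<not> linked c d" "\<And>c. c \<in> X \<Longrightarrow> \<not> linked d c"
    and sg: "\<And>c. c \<in> X \<Longrightarrow> sg' c = sg c"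
    and w: "weight B False d = 0"
  shows "gauss_poly odd_crossing (insert d X) B sg' = gauss_poly odd_crossing X B sg"
    and "gauss_poly zero_label (insert d X) B sg' = gauss_poly zero_label X B sg"
proof -
  have empty: "\<not> link_parity X P d" for P
    using l(2) link_parity_cong[of X d P d "\<lambda>g. False"] by (simp add: link_parity_def)
  have o: "odd_crossing (insert d X) c = odd_crossing X c" if "c \<in> X" for c
    using that fin d l by (simp add: odd_crossing_def link_parity_insert)
  have od: "\<not> odd_crossing (insert d X) d"
    using fin d empty by (simp add: odd_crossing_def link_parity_insert)
  have P: "link_parity X (\<lambda>g. \<not> odd_crossing (insert d X) g) c = link_parity X (\<lambda>g. \<not> odd_crossing X g) c" for c
    by (rule link_parity_cong) (simp add: o)
  have z: "zero_label (insert d X) c = zero_label X c" if "c \<in> X" for c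
    using that fin d l by (simp add: zero_label_def o link_parity_insert P)
  have zd: "\<not> zero_label (insert d X) d"
    using fin d empty od by (simp add: zero_label_def link_parity_insert)
  show "gauss_poly odd_crossing (insert d X) B sg' = gauss_poly odd_crossing X B sg"
    unfolding gauss_poly_def[of _ "insert d X"] sum.insert[OF fin d(1)]
    using od w by (simp add: gauss_poly_cong[of X "odd_crossing (insert d X)" odd_crossing, OF o sg])
  show "gauss_poly zero_label (insert d X) B sg' = gauss_poly zero_label X B sg"
    unfolding gauss_poly_def[of _ "insert d X"] sum.insert[OF fin d(1)]
    using zd w by (simp add: gauss_poly_cong[of X "zero_label (insert d X)" zero_label, OF z sg])
qed

text \<open>Every other chord is linked with both new ones or with neither, and the two get equal
  labels, so they change no parity and their opposite terms cancel. They may be linked with each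
  other, as depends on the orientations in C2; symmetry of that link gives both the same
  parity.\<close>

lemma gauss_poly_add_parallel:
  assumes fin: "finite X" and d: "d \<notin> X" "e \<notin> X" "d \<noteq> e"
    and ll: "\<not> linked d d" "\<not> linked e e" "linked d e = linked e d"
    and l: "\<And>c. c \<in> X \<Longrightarrow> linked c d = linked c e" "\<And>c. c \<in> X \<Longrightarrow> linked d c = linked e c"
    and sg: "\<And>c. c \<in> X \<Longrightarrow> sg' c = sg c" "sg' d = - sg' e"
    and w: "\<And>i. weight B i d = weight B i e"
  shows "gauss_poly odd_crossing (insert d (insert e X)) B sg' = gauss_poly odd_crossing X B sg"
    and "gauss_poly zero_label (insert d (insert e X)) B sg' = gauss_poly zero_label X B sg"
proof -
  let ?Y = "insert d (insert e X)"
  have eq: "link_parity X P d = link_parity X P e" for P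
    by (rule link_parity_cong) (simp add: l(2))
  have Y: "link_parity ?Y P c \<longleftrightarrow> (linked c d \<and> P d) \<noteq> ((linked c e \<and> P e) \<noteq> link_parity X P c)" for P c
    using fin d by (simp add: link_parity_insert)
  have o: "odd_crossing ?Y c = odd_crossing X c" if "c \<in> X" for c
    using that l(1) unfolding odd_crossing_def Y by auto
  have od: "odd_crossing ?Y d = odd_crossing ?Y e"
    using ll eq unfolding odd_crossing_def Y by auto
  have P: "link_parity X (\<lambda>g. \<not> odd_crossing ?Y g) c = link_parity X (\<lambda>g. \<not> odd_crossing X g) c" for c
    by (rule link_parity_cong) (simp add: o)
  have z: "zero_label ?Y c = zero_label X c" if "c \<in> X" for c
    using that l(1) unfolding zero_label_def Y P o[OF that] by (auto simp: od)
  have zd: "zero_label ?Y d = zero_label ?Y e"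
    using ll eq od unfolding zero_label_def Y by auto
  show "gauss_poly odd_crossing ?Y B sg' = gauss_poly odd_crossing X B sg"
    unfolding gauss_poly_def[of _ ?Y]
    using fin d by (simp add: gauss_poly_cong[of X "odd_crossing ?Y" odd_crossing, OF o sg(1)] od w sg(2))
  show "gauss_poly zero_label ?Y B sg' = gauss_poly zero_label X B sg"
    unfolding gauss_poly_def[of _ ?Y]
    using fin d by (simp add: gauss_poly_cong[of X "zero_label ?Y" zero_label, OF z sg(1)] zd w sg(2))
qed

text \<open>
  By \<open>tri\<close> the number of odd crossings in the triangle is even, so that the two other crossings of a
  triangle with an even crossing are both even or both odd.
\<close>

lemma triangle_labels:
  assumes fin: "finite X" and X: "a \<notin> X" "b \<notin> X" "d \<notin> X" "a \<noteq> b" "a \<noteq> d" "b \<noteq> d"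
    and X': "a' \<notin> X" "b' \<notin> X" "d' \<notin> X" "a' \<noteq> b'" "a' \<noteq> d'" "b' \<noteq> d'"
    and self: "\<not> linked a a" "\<not> linked b b" "\<not> linked d d"
      "\<not> linked a' a'" "\<not> linked b' b'" "\<not> linked d' d'"
    and sym: "linked b a = linked a b" "linked d a = linked a d" "linked d b = linked b d"
      "linked b' a' = linked a' b'" "linked d' a' = linked a' d'" "linked d' b' = linked b' d'"
    and flip: "linked a' b' = (\<not> linked a b)" "linked a' d' = (\<not> linked a d)"
      "linked b' d' = (\<not> linked b d)"
    and l: "\<And>c. c \<in> X \<Longrightarrow> linked c a' = linked c a" "\<And>c. c \<in> X \<Longrightarrow> linked c b' = linked c b"
      "\<And>c. c \<in> X \<Longrightarrow> linked c d' = linked c d"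
      "\<And>c. c \<in> X \<Longrightarrow> linked a' c = linked a c" "\<And>c. c \<in> X \<Longrightarrow> linked b' c = linked b c"
      "\<And>c. c \<in> X \<Longrightarrow> linked d' c = linked d c"
    and tri: "\<And>c. c \<in> X \<Longrightarrow> linked a c = (linked b c \<noteq> linked d c)"
    and lab: "lab = odd_crossing \<or> lab = zero_label"
  defines "Y \<equiv> insert a (insert b (insert d X))" and "Y' \<equiv> insert a' (insert b' (insert d' X))"
  shows "\<And>c. c \<in> X \<Longrightarrow> lab Y' c = lab Y c"
    and "lab Y' a' = lab Y a" "lab Y' b' = lab Y b" "lab Y' d' = lab Y d"
proof -
  have Y: "link_parity Y P c \<longleftrightarrow> (linked c a \<and> P a) \<noteq>
    ((linked c b \<and> P b) \<noteq> ((linked c d \<and> P d) \<noteq> link_parity X P c))" for P c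
    unfolding Y_def using fin X by (simp add: link_parity_insert)
  have Y': "link_parity Y' P c \<longleftrightarrow> (linked c a' \<and> P a') \<noteq>
    ((linked c b' \<and> P b') \<noteq> ((linked c d' \<and> P d') \<noteq> link_parity X P c))" for P c
    unfolding Y'_def using fin X' by (simp add: link_parity_insert)
  have eq: "link_parity X P a' = link_parity X P a" "link_parity X P b' = link_parity X P b"
    "link_parity X P d' = link_parity X P d" for P
    by (rule link_parity_cong, simp add: l)+
  \<comment> \<open>Summing \<open>tri\<close> over the crossings outside the triangle; the
    predicate is arbitrary, so this covers both indices.\<close>
  have sum: "link_parity X P a = (link_parity X P b \<noteq> link_parity X P d)" for P
    using fin tri
  proof (induction X rule: finite_induct)
    case (insert x F)
    then have "link_parity F P a = (link_parity F P b \<noteq> link_parity F P d)"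
      "linked a x = (linked b x \<noteq> linked d x)" by auto
    then show ?case using insert(1,2) by (auto simp: link_parity_insert)
  qed simp
  have o: "odd_crossing Y' c = odd_crossing Y c" if "c \<in> X" for c
    using that l(1-3) unfolding odd_crossing_def Y Y' by simp
  \<comment> \<open>Both links of a crossing to the rest of the triangle are negated, which leaves
    the parity of their number unchanged.\<close>
  have oa: "odd_crossing Y' a' = odd_crossing Y a" and ob: "odd_crossing Y' b' = odd_crossing Y b"
    and od: "odd_crossing Y' d' = odd_crossing Y d"
    unfolding odd_crossing_def Y Y' eq sym flip using self by auto
  \<comment> \<open>Links within the triangle are counted once from each side and cancel in the
    total; the remaining ones are governed by \<open>sum\<close>.\<close>
  have even: "odd_crossing Y a = (odd_crossing Y b \<noteq> odd_crossing Y d)"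
    unfolding odd_crossing_def Y sym using self sum by auto
  have P: "link_parity X (\<lambda>g. \<not> odd_crossing Y' g) c = link_parity X (\<lambda>g. \<not> odd_crossing Y g) c" for c
    by (rule link_parity_cong) (simp add: o)
  have z: "zero_label Y' c = zero_label Y c" if "c \<in> X" for c
    using that l(1-3) unfolding zero_label_def Y Y' o[OF that] oa ob od P by simp
  \<comment> \<open>For odd \<open>a\<close> the label is true on both sides. For even
    \<open>a\<close>, \<open>even\<close> makes \<open>b\<close> and \<open>d\<close> of the same
    kind: two negated links are counted, or none.\<close>
  have za: "zero_label Y' a' = zero_label Y a"
    using self even unfolding zero_label_def Y Y' P eq sym flip oa ob od by auto
  have zb: "zero_label Y' b' = zero_label Y b"
    using self even unfolding zero_label_def Y Y' P eq sym flip oa ob od by auto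
  have zd: "zero_label Y' d' = zero_label Y d"
    using self even unfolding zero_label_def Y Y' P eq sym flip oa ob od by auto
  show "\<And>c. c \<in> X \<Longrightarrow> lab Y' c = lab Y c"
    and "lab Y' a' = lab Y a" "lab Y' b' = lab Y b" "lab Y' d' = lab Y d"
    using lab o oa ob od z za zb zd by auto
qed

section \<open>What a move leaves unchanged outside its disc\<close>

lemma meets_disc_crossing:
  assumes D: "is_diagram D" and disc: "meets_disc p r ss D" and c: "c \<in> crossings D"
  shows "fst c \<in> strands ss \<longleftrightarrow> snd c \<in> strands ss"
    and "s \<in> set ss \<Longrightarrow> fst c \<noteq> fst s \<and> fst c \<noteq> snd s \<and> snd c \<noteq> fst s \<and> snd c \<noteq> snd s"
proof -
  have S: "{t \<in> {0..<1}. curve D t \<in> ball p r} = strands ss"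
    and ends: "\<forall>(a, b)\<in>set ss. \<forall>t\<in>{a, b}. t \<notin> Domain (double_points D)"
    using disc unfolding meets_disc_def by blast+
  have dp: "(fst c, snd c) \<in> double_points D" "(snd c, fst c) \<in> double_points D"
    using crossings_double_points[OF D] c double_points_sym by auto
  then have "curve D (fst c) = curve D (snd c)" by (simp add: double_points_def)
  then show "fst c \<in> strands ss \<longleftrightarrow> snd c \<in> strands ss"
    using diagram_unit(1,2)[OF D c] unfolding S[symmetric] by simp
  show "fst c \<noteq> fst s \<and> fst c \<noteq> snd s \<and> snd c \<noteq> fst s \<and> snd c \<noteq> snd s" if "s \<in> set ss"
  proof -
    have "fst s \<notin> Domain (double_points D)" "snd s \<notin> Domain (double_points D)"
      using bspec[OF ends that] by (auto simp: split_beta)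
    moreover have "fst c \<in> Domain (double_points D)" "snd c \<in> Domain (double_points D)"
      using dp by blast+
    ultimately show ?thesis by metis
  qed
qed

text \<open>The curves agree near \<open>t\<close> at least to the right of it, and a one-sided
  derivative already determines the tangent.\<close>

lemma tangent_eq_outside:
  assumes D: "is_diagram D" and D': "is_diagram D'"
    and eq: "\<And>t. t \<in> {0..<1} - strands ss \<Longrightarrow> curve D t = curve D' t"
    and t: "t \<in> {0..<1}" "\<And>s. s \<in> set ss \<Longrightarrow> t \<notin> {fst s..snd s}"
  shows "tangent D t = tangent D' t"
proof -
  have "open (- (\<Union>s\<in>set ss. {fst s..snd s}) \<inter> {..<1})"
    by (intro open_Int open_Compl closed_UN) auto
  moreover have "t \<in> - (\<Union>s\<in>set ss. {fst s..snd s}) \<inter> {..<1}" using t by auto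
  ultimately obtain e where e: "e > 0"
    and ball: "ball t e \<subseteq> - (\<Union>s\<in>set ss. {fst s..snd s}) \<inter> {..<1}"
    using open_contains_ball by blast
  \<comment> \<open>The interval extends to the right only: at \<open>t = 0\<close> the parameters
    to the left lie outside the unit interval, where agreement is not assumed.\<close>
  let ?I = "{t..<t + e}"
  have I: "curve D u = curve D' u" if "u \<in> ?I" for u
  proof (rule eq)
    have "u \<in> ball t e" using that by (auto simp: dist_real_def)
    then have "u \<in> - (\<Union>s\<in>set ss. {fst s..snd s}) \<inter> {..<1}" using ball by blast
    then show "u \<in> {0..<1} - strands ss"
      using that t(1) by (force simp: strands_def strand_def)
  qed
  have "(curve D has_vector_derivative tangent D t) (at t within ?I)"
    using curve_has_tangent[OF D] has_vector_derivative_at_within by blast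
  then have "(curve D' has_vector_derivative tangent D t) (at t within ?I)"
    by (rule has_vector_derivative_transform[rotated 2]) (use I e in auto)
  moreover have "(curve D' has_vector_derivative tangent D' t) (at t within ?I)"
    using curve_has_tangent[OF D'] has_vector_derivative_at_within by blast
  moreover have "at t within ?I \<noteq> bot"
    using e by (simp add: trivial_limit_within islimpt_greaterThanLessThan1)
  ultimately show ?thesis by (metis vector_derivative_within)
qed

text \<open>Splits both diagrams into the tangle of the move and a common rest. It is applied as an
  elimination rule in the proofs for all ten Reidemeister moves.\<close>

lemma local_change_decompose:
  assumes D: "is_diagram D" and D': "is_diagram D'" and lc: "local_change ss D D'"
    and T: "tangle ss D X V B" and T': "tangle ss D' X' V' B'"
  obtains X0 B0 where
    "crossings D = X \<union> X0" "crossings D' = X' \<union> X0" "X \<inter> X0 = {}" "X' \<inter> X0 = {}"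
    "bars D = B \<union> B0" "bars D' = B' \<union> B0" "B \<inter> B0 = {}" "B' \<inter> B0 = {}"
    "finite X0" "finite B0"
    "\<And>c s. c \<in> X0 \<Longrightarrow> s \<in> set ss \<Longrightarrow> fst c \<notin> strand s \<and> snd c \<notin> strand s"
    "\<And>t s. t \<in> B0 \<Longrightarrow> s \<in> set ss \<Longrightarrow> t \<notin> strand s"
    "\<And>c. c \<in> X0 \<Longrightarrow> crossing_sign D' c = crossing_sign D c"
proof
  let ?S = "strands ss"
  let ?X0 = "crossings D - ?S \<times> ?S" and ?B0 = "bars D - ?S"
  obtain p r where disc: "meets_disc p r ss D" "meets_disc p r ss D'"
    and curve: "\<And>t. t \<in> {0..<1} - ?S \<Longrightarrow> curve D t = curve D' t"
    and X0: "?X0 = crossings D' - ?S \<times> ?S"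
    and B0: "?B0 = bars D' - ?S"
    using lc unfolding local_change_def by blast
  have X: "crossings D \<inter> ?S \<times> ?S = X" "crossings D' \<inter> ?S \<times> ?S = X'"
    and B: "bars D \<inter> ?S = B" "bars D' \<inter> ?S = B'"
    using T T' unfolding tangle_def by blast+
  show "crossings D = X \<union> ?X0" "X \<inter> ?X0 = {}" "bars D = B \<union> ?B0" "B \<inter> ?B0 = {}"
    using X B by blast+
  show "crossings D' = X' \<union> ?X0" "X' \<inter> ?X0 = {}" unfolding X0 using X by blast+
  show "bars D' = B' \<union> ?B0" "B' \<inter> ?B0 = {}" unfolding B0 using B by blast+
  show "finite ?X0" using diagram_finite_crossings[OF D] by blast
  show "finite ?B0" using D unfolding is_diagram_def by blast
  \<comment> \<open>The two ends of a crossing are mapped to one point of the plane, so a crossing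
    with an end outside the disc has both ends outside.\<close>
  have out: "fst c \<notin> ?S" "snd c \<notin> ?S" if "c \<in> ?X0" for c
    using meets_disc_crossing(1)[OF D disc(1), of c] that by (auto simp: mem_Times_iff)
  then show "\<And>c s. c \<in> ?X0 \<Longrightarrow> s \<in> set ss \<Longrightarrow> fst c \<notin> strand s \<and> snd c \<notin> strand s"
    unfolding strands_def by blast
  show "\<And>t s. t \<in> ?B0 \<Longrightarrow> s \<in> set ss \<Longrightarrow> t \<notin> strand s"
    unfolding strands_def by blast
  show "crossing_sign D' c = crossing_sign D c" if "c \<in> ?X0" for c
  proof -
    have c: "c \<in> crossings D" using that by blast
    have "fst c \<notin> {fst s..snd s} \<and> snd c \<notin> {fst s..snd s}" if "s \<in> set ss" for s
      using out[OF \<open>c \<in> ?X0\<close>] meets_disc_crossing(2)[OF D disc(1) c that] that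
      unfolding strands_def strand_def by force
    then have "tangent D (fst c) = tangent D' (fst c)" "tangent D (snd c) = tangent D' (snd c)"
      using tangent_eq_outside[OF D D' curve] diagram_unit[OF D c] by blast+
    then show ?thesis by (simp add: crossing_sign_def)
  qed
qed

lemma local_change_disjoint:
  assumes "local_change ss D D'" "i < length ss" "j < length ss" "i \<noteq> j"
  shows "strand (ss ! i) \<inter> strand (ss ! j) = {}"
proof -
  have "{fst (ss ! i)..snd (ss ! i)} \<inter> {fst (ss ! j)..snd (ss ! j)} = {}"
    using assms unfolding local_change_def by blast
  then show ?thesis unfolding strand_def by fastforce
qed

lemma same_polysI:
  assumes "is_diagram D" "is_diagram D'"
    and "\<And>lab. lab = odd_crossing \<or> lab = zero_label \<Longrightarrow>
      gauss_poly lab (crossings D) (bars D) (crossing_sign D) =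
      gauss_poly lab (crossings D') (bars D') (crossing_sign D')"
  shows "same_polys D D'"
  unfolding same_polys_def using assms by (simp add: Q_poly_eq Qz_poly_eq)

lemma same_polys_same_crossings:
  assumes "is_diagram D" "is_diagram D'" "crossings D = X" "crossings D' = X"
    and "\<And>c. c \<in> X \<Longrightarrow> crossing_sign D' c = crossing_sign D c"
    and "\<And>c. c \<in> X \<Longrightarrow> bar_odd (bars D') (fst c) (snd c) = bar_odd (bars D) (fst c) (snd c)"
    and "\<And>c. c \<in> X \<Longrightarrow> bar_odd (bars D') (snd c) (fst c) = bar_odd (bars D) (snd c) (fst c)"
  shows "same_polys D D'"
  by (rule same_polys_iso[of D D' "\<lambda>c. c"]) (use assms in \<open>auto intro: weight_cong simp: bij_betw_def\<close>)

section \<open>Moves that keep the classical crossings: V1, V2, V3, T1, T2\<close>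

lemma move_V1_same_polys:
  assumes D: "is_diagram D" "is_diagram D'" and "move_V1 D D'"
  shows "same_polys D D'"
proof -
  obtain s x y where lc: "local_change [s] D D'" "tangle [s] D {} {} {}" "tangle [s] D' {} {(x, y)} {}"
    using assms(3) unfolding move_V1_def by blast
  show ?thesis
    by (rule local_change_decompose[OF D lc], rule same_polys_same_crossings[OF D]) auto
qed

lemma move_V2_same_polys:
  assumes D: "is_diagram D" "is_diagram D'" and "move_V2 D D'"
  shows "same_polys D D'"
proof -
  obtain s1 s2 V where lc: "local_change [s1, s2] D D'" "tangle [s1, s2] D {} {} {}"
    "tangle [s1, s2] D' {} V {}"
    using assms(3) unfolding move_V2_def by blast
  show ?thesis
    by (rule local_change_decompose[OF D lc], rule same_polys_same_crossings[OF D]) auto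
qed

lemma move_V3_same_polys:
  assumes D: "is_diagram D" "is_diagram D'" and "move_V3 D D'"
  shows "same_polys D D'"
proof -
  obtain ss V V' where lc: "local_change ss D D'" "tangle ss D {} V {}" "tangle ss D' {} V' {}"
    using assms(3) unfolding move_V3_def third_move_def by (elim exE conjE) (rule that)
  show ?thesis
    by (rule local_change_decompose[OF D lc], rule same_polys_same_crossings[OF D]) auto
qed

lemma move_T1_same_polys:
  assumes D: "is_diagram D" "is_diagram D'" and "move_T1 D D'"
  shows "same_polys D D'"
proof -
  obtain s p q where lc: "local_change [s] D D'" "tangle [s] D {} {} {}" "tangle [s] D' {} {} {p, q}"
    and pq: "p \<noteq> q"
    using assms(3) unfolding move_T1_def by blast
  have strand: "p \<in> strand s" "q \<in> strand s"
    using lc(3) unfolding tangle_def strands_def by auto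
  show ?thesis
  proof (rule local_change_decompose[OF D lc], rule same_polys_same_crossings[OF D])
    fix X0 :: "(real \<times> real) set" and B0 :: "real set" and c
    assume c: "c \<in> X0" and out: "\<And>c t. c \<in> X0 \<Longrightarrow> t \<in> set [s] \<Longrightarrow> fst c \<notin> strand t \<and> snd c \<notin> strand t"
      and B: "bars D = {} \<union> B0" "bars D' = {p, q} \<union> B0" "{p, q} \<inter> B0 = {}" "finite B0"
    \<comment> \<open>Both new bars lie on one strand without ends of \<open>c\<close>, so an arc
      between the ends contains both bars or none.\<close>
    have o: "fst c \<notin> strand s" "snd c \<notin> strand s" using out[OF c] by auto
    show "bar_odd (bars D') (fst c) (snd c) = bar_odd (bars D) (fst c) (snd c)"
      using B pq on_arc_slide(3)[OF strand o] by (auto simp: bar_odd_insert)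
    show "bar_odd (bars D') (snd c) (fst c) = bar_odd (bars D) (snd c) (fst c)"
      using B pq on_arc_slide(3)[OF strand o(2,1)] by (auto simp: bar_odd_insert)
  qed auto
qed

lemma move_T2_same_polys:
  assumes D: "is_diagram D" "is_diagram D'" and "move_T2 D D'"
  shows "same_polys D D'"
proof -
  obtain s1 s2 V V' p p' x x' where lc: "local_change [s1, s2] D D'"
    "tangle [s1, s2] D {} V {p}" "tangle [s1, s2] D' {} V' {p'}"
    and sub: "{x, p, x', p'} \<subseteq> strand s1"
    using assms(3) unfolding move_T2_def by (elim exE conjE) (rule that)
  have strand: "p' \<in> strand s1" "p \<in> strand s1" using sub by auto
  show ?thesis
  proof (rule local_change_decompose[OF D lc], rule same_polys_same_crossings[OF D])
    fix X0 :: "(real \<times> real) set" and B0 :: "real set" and c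
    assume c: "c \<in> X0"
      and out: "\<And>c t. c \<in> X0 \<Longrightarrow> t \<in> set [s1, s2] \<Longrightarrow> fst c \<notin> strand t \<and> snd c \<notin> strand t"
      and B: "bars D = {p} \<union> B0" "bars D' = {p'} \<union> B0" "{p} \<inter> B0 = {}" "{p'} \<inter> B0 = {}" "finite B0"
    have o: "fst c \<notin> strand s1" "snd c \<notin> strand s1" using out[OF c] by auto
    show "bar_odd (bars D') (fst c) (snd c) = bar_odd (bars D) (fst c) (snd c)"
      using B on_arc_slide(3)[OF strand o] by (auto simp: bar_odd_insert)
    show "bar_odd (bars D') (snd c) (fst c) = bar_odd (bars D) (snd c) (fst c)"
      using B on_arc_slide(3)[OF strand o(2,1)] by (auto simp: bar_odd_insert)
  qed auto
qed

section \<open>Moves that change classical crossings: C1, C2, V4, T3, C3\<close>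

lemma on_arc_slide_ends:
  assumes "x \<in> strand s1" "x' \<in> strand s1" "y \<in> strand s2" "y' \<in> strand s2"
    and "strand s1 \<inter> strand s2 = {}" "t \<notin> strand s1" "t \<notin> strand s2"
  shows "on_arc x y t = on_arc x' y' t" "on_arc y x t = on_arc y' x' t"
proof -
  have apart: "y \<notin> strand s1" "y' \<notin> strand s1" "x \<notin> strand s2" "x' \<notin> strand s2"
    using assms(1-5) by auto
  show "on_arc x y t = on_arc x' y' t"
    using on_arc_slide(1)[OF assms(1,2) apart(1) assms(6)] on_arc_slide(2)[OF assms(3,4) apart(4) assms(7)]
    by simp
  show "on_arc y x t = on_arc y' x' t"
    using on_arc_slide(2)[OF assms(1,2) apart(1) assms(6)] on_arc_slide(1)[OF assms(3,4) apart(4) assms(7)]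
    by simp
qed

lemma weight_slide:
  assumes "x \<in> strand s1" "x' \<in> strand s1" "y \<in> strand s2" "y' \<in> strand s2"
    and "strand s1 \<inter> strand s2 = {}"
    and "\<And>t. t \<in> B \<Longrightarrow> t \<notin> strand s1" "\<And>t. t \<in> B \<Longrightarrow> t \<notin> strand s2"
  shows "weight B i (x', y') = weight B i (x, y)"
proof -
  have "bar_odd B x' y' = bar_odd B x y" "bar_odd B y' x' = bar_odd B y x"
    by (rule bar_odd_cong; use assms(6,7) on_arc_slide_ends[OF assms(1-5)] in simp)+
  then show ?thesis by (intro weight_cong) simp_all
qed

lemma linked_slide:
  assumes "x \<in> strand s1" "x' \<in> strand s1" "y \<in> strand s2" "y' \<in> strand s2"
    and "strand s1 \<inter> strand s2 = {}"
    and "fst c \<notin> strand s1" "snd c \<notin> strand s1" "fst c \<notin> strand s2" "snd c \<notin> strand s2"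
  shows "linked c (x', y') = linked c (x, y)" "linked (x', y') c = linked (x, y) c"
proof -
  show "linked c (x', y') = linked c (x, y)"
    using assms on_arc_slide(3)[of x s1 x'] on_arc_slide(3)[of y s2 y'] by (simp add: linked_def)
  show "linked (x', y') c = linked (x, y) c"
    using on_arc_slide_ends(1)[OF assms(1-5)] assms(6-9) by (simp add: linked_def)
qed

text \<open>Exchanging the ends of \<open>c\<close> passes to the complementary arc, which negates
  both memberships of the ends of \<open>g\<close>.\<close>

lemma linked_swap_left:
  assumes "fst c \<noteq> snd c" "fst g \<notin> {fst c, snd c}" "snd g \<notin> {fst c, snd c}"
  shows "linked (prod.swap c) g = linked c g"
  using assms by (auto simp: linked_def on_arc_swap[of "fst c" "snd c"])

lemma linked_swap_right: "linked c (prod.swap g) = linked c g"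
  by (auto simp: linked_def)

lemma same_polys_replace_crossing:
  assumes D: "is_diagram D" "is_diagram D'"
    and X: "crossings D = insert d X" "crossings D' = insert d' X" "d \<notin> X" "d' \<notin> X"
    and sg: "\<And>c. c \<in> X \<Longrightarrow> crossing_sign D' c = crossing_sign D c"
      "crossing_sign D' d' = crossing_sign D d"
    and l: "\<And>c. c \<in> X \<Longrightarrow> linked c d' = linked c d" "\<And>c. c \<in> X \<Longrightarrow> linked d' c = linked d c"
    and w: "\<And>c i. c \<in> X \<Longrightarrow> weight (bars D') i c = weight (bars D) i c"
      "\<And>i. weight (bars D') i d' = weight (bars D) i d"
  shows "same_polys D D'"
proof (rule same_polys_iso[OF D, of "\<lambda>c. if c = d then d' else c"])
  have "\<not> linked d d" "\<not> linked d' d'"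
    using diagram_unit(3)[OF D(1), of d] diagram_unit(3)[OF D(2), of d'] X by (auto simp: not_linked_self)
  then show "linked (if c = d then d' else c) (if g = d then d' else g) = linked c g"
    if "c \<in> crossings D" "g \<in> crossings D" for c g
    using that X l by (cases "c = d"; cases "g = d") simp_all
  show "bij_betw (\<lambda>c. if c = d then d' else c) (crossings D) (crossings D')"
    using X by (auto simp: bij_betw_def inj_on_def)
qed (use X sg w in auto)

lemma not_linked_within_strand:
  assumes "x \<in> strand s" "y \<in> strand s" "u \<notin> strand s" "v \<notin> strand s" "x \<noteq> y"
  shows "\<not> linked (x, y) (u, v)"
  using assms on_arc_same_strand(3)[of x s y] by (simp add: linked_def)

lemma move_C1_same_polys:
  assumes D: "is_diagram D" "is_diagram D'" and "move_C1 D D'"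
  shows "same_polys D D'"
proof -
  obtain s x y where lc: "local_change [s] D D'" "tangle [s] D {} {} {}" "tangle [s] D' {(x, y)} {} {}"
    using assms(3) unfolding move_C1_def by blast
  have strand: "x \<in> strand s" "y \<in> strand s" and xy: "(x, y) \<in> crossings D'"
    using lc(3) unfolding tangle_def strands_def by auto
  have neq: "x \<noteq> y" using diagram_unit(3)[OF D(2) xy] by simp
  show ?thesis
  proof (rule local_change_decompose[OF D lc], rule same_polysI[OF D])
    fix X0 :: "(real \<times> real) set" and B0 :: "real set"
      and lab :: "(real \<times> real) set \<Rightarrow> real \<times> real \<Rightarrow> bool"
    assume lab: "lab = odd_crossing \<or> lab = zero_label"
      and X: "crossings D = {} \<union> X0" "crossings D' = {(x, y)} \<union> X0" "{(x, y)} \<inter> X0 = {}"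
      and B: "bars D = {} \<union> B0" "bars D' = {} \<union> B0" and fin: "finite X0"
      and out: "\<And>c t. c \<in> X0 \<Longrightarrow> t \<in> set [s] \<Longrightarrow> fst c \<notin> strand t \<and> snd c \<notin> strand t"
      and outB: "\<And>b t. b \<in> B0 \<Longrightarrow> t \<in> set [s] \<Longrightarrow> b \<notin> strand t"
      and sg: "\<And>c. c \<in> X0 \<Longrightarrow> crossing_sign D' c = crossing_sign D c"
    have o: "fst c \<notin> strand s" "snd c \<notin> strand s" if "c \<in> X0" for c using out[OF that] by auto
    have l1: "\<not> linked c (x, y)" if "c \<in> X0" for c
      using on_arc_slide(3)[OF strand o[OF that]] by (simp add: linked_def)
    have l2: "\<not> linked (x, y) c" if "c \<in> X0" for c
      using not_linked_within_strand[OF strand o[OF that] neq] by simp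
    \<comment> \<open>The loop of the kink stays within the strand, and no bar lies there. Hence at
      label false one factor of the weight is \<open>var_t ^ 0 - 1\<close>.\<close>
    have none: "\<not> bar_odd B0 a b" if "a \<in> strand s" "b \<in> strand s" "a < b" for a b
    proof -
      have "\<not> on_arc a b t" if "t \<in> B0" for t
        using on_arc_same_strand(3)[of a s b t] outB[OF that] \<open>a \<in> strand s\<close> \<open>b \<in> strand s\<close> \<open>a < b\<close> by simp
      then show ?thesis by (simp add: bar_odd_def)
    qed
    have "weight B0 False (x, y) = 0"
    proof (cases "x < y")
      case True
      then show ?thesis using none[OF strand] by (simp add: weight_def)
    next
      case False
      then have "y < x" using neq by simp
      then show ?thesis using none[OF strand(2,1)] by (simp add: weight_def)
    qed
    then show "gauss_poly lab (crossings D) (bars D) (crossing_sign D) =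
      gauss_poly lab (crossings D') (bars D') (crossing_sign D')"
      using lab X B l1 l2 sg
        gauss_poly_add_isolated[OF fin, of "(x, y)" "crossing_sign D'" "crossing_sign D" B0]
        not_linked_self[of "(x, y)"] neq by auto
  qed
qed

lemma move_C2_same_polys:
  assumes D: "is_diagram D" "is_diagram D'" and "move_C2 D D'"
  shows "same_polys D D'"
proof -
  obtain s1 s2 x1 x2 y1 y2 where lc: "local_change [s1, s2] D D'" "tangle [s1, s2] D {} {} {}"
    "tangle [s1, s2] D' {(x1, y1), (x2, y2)} {} {}"
    and sub: "{x1, x2} \<subseteq> strand s1" "{y1, y2} \<subseteq> strand s2" and x: "x1 \<noteq> x2"
    and opp: "crossing_sign D' (x1, y1) = - crossing_sign D' (x2, y2)"
    using assms(3) unfolding move_C2_def by (elim exE conjE) (rule that)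
  have strand: "x1 \<in> strand s1" "x2 \<in> strand s1" "y1 \<in> strand s2" "y2 \<in> strand s2"
    using sub by auto
  have disj: "strand s1 \<inter> strand s2 = {}" using local_change_disjoint[OF lc(1), of 0 1] by simp
  have cr: "(x1, y1) \<in> crossings D'" "(x2, y2) \<in> crossings D'"
    using lc(3) unfolding tangle_def by blast+
  show ?thesis
  proof (rule local_change_decompose[OF D lc], rule same_polysI[OF D])
    fix X0 :: "(real \<times> real) set" and B0 :: "real set"
      and lab :: "(real \<times> real) set \<Rightarrow> real \<times> real \<Rightarrow> bool"
    assume lab: "lab = odd_crossing \<or> lab = zero_label"
      and X: "crossings D = {} \<union> X0" "crossings D' = {(x1, y1), (x2, y2)} \<union> X0"
        "{(x1, y1), (x2, y2)} \<inter> X0 = {}"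
      and B: "bars D = {} \<union> B0" "bars D' = {} \<union> B0" and fin: "finite X0"
      and out: "\<And>c t. c \<in> X0 \<Longrightarrow> t \<in> set [s1, s2] \<Longrightarrow> fst c \<notin> strand t \<and> snd c \<notin> strand t"
      and outB: "\<And>b t. b \<in> B0 \<Longrightarrow> t \<in> set [s1, s2] \<Longrightarrow> b \<notin> strand t"
      and sg: "\<And>c. c \<in> X0 \<Longrightarrow> crossing_sign D' c = crossing_sign D c"
    have o: "fst c \<notin> strand s1" "snd c \<notin> strand s1" "fst c \<notin> strand s2" "snd c \<notin> strand s2"
      if "c \<in> X0" for c using out[OF that] by auto
    have l: "linked c (x1, y1) = linked c (x2, y2)" "linked (x1, y1) c = linked (x2, y2) c"
      if "c \<in> X0" for c
      using linked_slide[OF strand disj o[OF that]] by simp_all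
    have oB: "b \<notin> strand s1" "b \<notin> strand s2" if "b \<in> B0" for b using outB[OF that] by auto
    have w: "weight B0 i (x1, y1) = weight B0 i (x2, y2)" for i
      using weight_slide[OF strand disj oB] by simp
    have neq: "(x1, y1) \<noteq> (x2, y2)" "x1 \<noteq> y1" "x2 \<noteq> y2" using x strand disj by auto
    show "gauss_poly lab (crossings D) (bars D) (crossing_sign D) =
      gauss_poly lab (crossings D') (bars D') (crossing_sign D')"
      using lab X B
        gauss_poly_add_parallel[OF fin _ _ neq(1) _ _ linked_sym[OF D(2) cr] l sg opp w]
        not_linked_self[of "(x1, y1)"] not_linked_self[of "(x2, y2)"] neq by auto
  qed
qed

text \<open>The arc passing over the crossing virtually leaves no trace in the Gauss diagram; the
  classical crossing merely slides along its two strands.\<close>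

lemma move_V4_same_polys:
  assumes D: "is_diagram D" "is_diagram D'" and "move_V4 D D'"
  shows "same_polys D D'"
proof -
  obtain ss V V' x12 x13 x21 x23 x31 x32 y12 y13 y21 y23 y31 y32 where len: "length ss = 3"
    and lc: "local_change ss D D'" "tangle ss D {(x23, x32)} V {}" "tangle ss D' {(y23, y32)} V' {}"
    and sub: "{x21, x23, y21, y23} \<subseteq> strand (ss ! 1)" "{x31, x32, y31, y32} \<subseteq> strand (ss ! 2)"
    and sgn: "crossing_sign D (x23, x32) = crossing_sign D' (y23, y32)"
    using assms(3) unfolding move_V4_def third_move_def by (elim exE conjE) (rule that)
  have strand: "x23 \<in> strand (ss ! 1)" "y23 \<in> strand (ss ! 1)"
    "x32 \<in> strand (ss ! 2)" "y32 \<in> strand (ss ! 2)"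
    using sub by auto
  have disj: "strand (ss ! 1) \<inter> strand (ss ! 2) = {}"
    using local_change_disjoint[OF lc(1), of 1 2] len by simp
  have mem: "ss ! 1 \<in> set ss" "ss ! 2 \<in> set ss" using len by auto
  show ?thesis
  proof (rule local_change_decompose[OF D lc])
    fix X0 :: "(real \<times> real) set" and B0 :: "real set"
    assume X: "crossings D = {(x23, x32)} \<union> X0" "crossings D' = {(y23, y32)} \<union> X0"
        "{(x23, x32)} \<inter> X0 = {}" "{(y23, y32)} \<inter> X0 = {}"
      and B: "bars D = {} \<union> B0" "bars D' = {} \<union> B0"
      and out: "\<And>c t. c \<in> X0 \<Longrightarrow> t \<in> set ss \<Longrightarrow> fst c \<notin> strand t \<and> snd c \<notin> strand t"
      and outB: "\<And>b t. b \<in> B0 \<Longrightarrow> t \<in> set ss \<Longrightarrow> b \<notin> strand t"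
      and sg: "\<And>c. c \<in> X0 \<Longrightarrow> crossing_sign D' c = crossing_sign D c"
    show "same_polys D D'"
    proof (rule same_polys_replace_crossing[OF D, of "(x23, x32)" X0 "(y23, y32)"])
      fix c assume c: "c \<in> X0"
      show "linked c (y23, y32) = linked c (x23, x32)" "linked (y23, y32) c = linked (x23, x32) c"
        using linked_slide[OF strand disj, of c] out[OF c] mem by simp_all
    next
      show "weight (bars D') i (y23, y32) = weight (bars D) i (x23, x32)" for i
        using weight_slide[OF strand disj outB[OF _ mem(1)] outB[OF _ mem(2)]] B by simp
    qed (use X B sg sgn in auto)
  qed
qed

lemma move_T3_same_polys:
  assumes D: "is_diagram D" "is_diagram D'" and "move_T3 D D'"
  shows "same_polys D D'"
proof -
  obtain s1 s2 x y p p' q q' x1 x2 x3 y1 y2 y3 V' where lc: "local_change [s1, s2] D D'"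
    "tangle [s1, s2] D {(x, y)} {} {p, p', q, q'}" "tangle [s1, s2] D' {(y2, x2)} V' {}"
    and sub: "{p, x, p', x1, x2, x3} \<subseteq> strand s1" "{q, y, q', y1, y2, y3} \<subseteq> strand s2"
    and ord: "p < x" "x < p'" "q < y" "y < q'"
    and sgn: "crossing_sign D (x, y) = crossing_sign D' (y2, x2)"
    using assms(3) unfolding move_T3_def by (elim exE conjE) (rule that)
  have strand: "x \<in> strand s1" "x2 \<in> strand s1" "y \<in> strand s2" "y2 \<in> strand s2"
    and bar: "p \<in> strand s1" "p' \<in> strand s1" "q \<in> strand s2" "q' \<in> strand s2"
    using sub by auto
  have disj: "strand s1 \<inter> strand s2 = {}" using local_change_disjoint[OF lc(1), of 0 1] by simp
  then have apart: "x \<notin> strand s2" "y \<notin> strand s1" "x2 \<noteq> y2" using strand by auto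
  have distinct: "p \<notin> {p', q, q'}" "p' \<notin> {q, q'}" "q \<noteq> q'"
    using bar disj ord by auto
  show ?thesis
  proof (rule local_change_decompose[OF D lc])
    fix X0 :: "(real \<times> real) set" and B0 :: "real set"
    assume X: "crossings D = {(x, y)} \<union> X0" "crossings D' = {(y2, x2)} \<union> X0"
        "{(x, y)} \<inter> X0 = {}" "{(y2, x2)} \<inter> X0 = {}"
      and B: "bars D = {p, p', q, q'} \<union> B0" "bars D' = {} \<union> B0"
        "{p, p', q, q'} \<inter> B0 = {}" "finite B0"
      and out: "\<And>c t. c \<in> X0 \<Longrightarrow> t \<in> set [s1, s2] \<Longrightarrow> fst c \<notin> strand t \<and> snd c \<notin> strand t"
      and outB: "\<And>b t. b \<in> B0 \<Longrightarrow> t \<in> set [s1, s2] \<Longrightarrow> b \<notin> strand t"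
      and sg: "\<And>c. c \<in> X0 \<Longrightarrow> crossing_sign D' c = crossing_sign D c"
    have bars: "bar_odd (bars D) a b \<longleftrightarrow>
      on_arc a b p \<noteq> (on_arc a b p' \<noteq> (on_arc a b q \<noteq> (on_arc a b q' \<noteq> bar_odd B0 a b)))" for a b
      using B distinct by (simp add: bar_odd_insert)
    show "same_polys D D'"
    proof (rule same_polys_replace_crossing[OF D, of "(x, y)" X0 "(y2, x2)"])
      fix c i assume c: "c \<in> X0"
      have o: "fst c \<notin> strand s1" "snd c \<notin> strand s1" "fst c \<notin> strand s2" "snd c \<notin> strand s2"
        using out[OF c] by auto
      show "linked c (y2, x2) = linked c (x, y)"
        using linked_swap_right[of c "(x2, y2)"] linked_slide(1)[OF strand disj o] by simp
      have "linked (y2, x2) c = linked (x2, y2) c"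
        using linked_swap_left[of "(x2, y2)" c] apart o strand by auto
      then show "linked (y2, x2) c = linked (x, y) c"
        using linked_slide(2)[OF strand disj o] by simp
      \<comment> \<open>Seen from ends outside the disc, \<open>p\<close> and \<open>p'\<close> are
        on the same side, and so are \<open>q\<close> and \<open>q'\<close>; the four bars cancel in
        pairs.\<close>
      have "bar_odd (bars D) a b = bar_odd B0 a b"
        if "a \<notin> strand s1" "b \<notin> strand s1" "a \<notin> strand s2" "b \<notin> strand s2" for a b
        unfolding bars on_arc_slide(3)[OF bar(1,2) that(1,2)] on_arc_slide(3)[OF bar(3,4) that(3,4)] by auto
      then show "weight (bars D') i c = weight (bars D) i c"
        using o B by (intro weight_cong) simp_all
    next
      fix i
      have oB: "b \<notin> strand s1" "b \<notin> strand s2" if "b \<in> B0" for b using outB[OF that] by auto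
      have "weight (bars D') i (y2, x2) = weight B0 i (x2, y2)"
        using B by (intro weight_cong_swap) simp_all
      also have "\<dots> = weight B0 i (x, y)" by (rule weight_slide[OF strand disj oB])
      also have "\<dots> = weight (bars D) i (x, y)"
      proof -
        \<comment> \<open>The arc from \<open>x\<close> to \<open>y\<close> contains just
          \<open>p'\<close> and \<open>q\<close> of the four bars, and the arc from \<open>y\<close>
          to \<open>x\<close> just \<open>q'\<close> and \<open>p\<close>.\<close>
        have "bar_odd (bars D) x y = bar_odd B0 x y" "bar_odd (bars D) y x = bar_odd B0 y x"
        unfolding bars using ord apart strand bar
        by (simp_all add: on_arc_same_strand(1)[of x s1] on_arc_same_strand(2)[of x s1]
            on_arc_same_strand(1)[of y s2] on_arc_same_strand(2)[of y s2])
        then show ?thesis by (intro weight_cong) simp_all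
      qed
      finally show "weight (bars D') i (y2, x2) = weight (bars D) i (x, y)" .
    qed (use X B sg sgn in auto)
  qed
qed

text \<open>The crossings share the strand \<open>s1\<close>. Whether the end \<open>q\<close> lies
  on the arc bounded by \<open>p\<close> and \<open>u\<close> is decided by the order of
  \<open>p\<close> and \<open>q\<close>, which the move reverses, while the position of the other
  end \<open>v\<close> is unaffected. Exactly one of the two memberships changes.\<close>

lemma linked_flip:
  assumes "p \<in> strand s1" "q \<in> strand s1" "p' \<in> strand s1" "q' \<in> strand s1"
    and "u \<in> strand s2" "u' \<in> strand s2" "v \<in> strand s3" "v' \<in> strand s3"
    and "strand s1 \<inter> strand s2 = {}" "strand s1 \<inter> strand s3 = {}" "strand s2 \<inter> strand s3 = {}"
    and "p < q \<longleftrightarrow> q' < p'" "p \<noteq> q" "p' \<noteq> q'"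
  shows "linked (p', u') (q', v') = (\<not> linked (p, u) (q, v))"
    and "linked (u', p') (q', v') = (\<not> linked (u, p) (q, v))"
    and "linked (u', p') (v', q') = (\<not> linked (u, p) (v, q))"
proof -
  have apart: "u \<notin> strand s1" "u' \<notin> strand s1" "v \<notin> strand s1" "v' \<notin> strand s1" "v \<notin> strand s2"
    "v' \<notin> strand s2" "p \<notin> strand s3" "u \<notin> strand s3" using assms by auto
  have "on_arc p' u' v' = on_arc p u v" "on_arc u' p' v' = on_arc u p v"
    using on_arc_slide_ends[OF assms(3,1,6,5,9) apart(4,6)] on_arc_slide(3)[OF assms(7,8) apart(7,8)]
      on_arc_slide(3)[OF assms(7,8) apart(8,7)] by simp_all
  then show "linked (p', u') (q', v') = (\<not> linked (p, u) (q, v))"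
    "linked (u', p') (q', v') = (\<not> linked (u, p) (q, v))"
    "linked (u', p') (v', q') = (\<not> linked (u, p) (v, q))"
    using assms apart by (auto simp: linked_def on_arc_same_strand(1,2)[of _ s1])
qed

lemma sum_insert3_eq:
  assumes "finite X" "a \<notin> X" "b \<notin> X" "d \<notin> X" "a \<noteq> b" "a \<noteq> d" "b \<noteq> d"
    and "a' \<notin> X" "b' \<notin> X" "d' \<notin> X" "a' \<noteq> b'" "a' \<noteq> d'" "b' \<noteq> d'"
    and "f a = g a'" "f b = g b'" "f d = g d'" "\<And>c. c \<in> X \<Longrightarrow> f c = g c"
  shows "sum f (insert a (insert b (insert d X))) = sum g (insert a' (insert b' (insert d' X)))"
  using assms by simp

lemma move_C3_same_polys:
  assumes D: "is_diagram D" "is_diagram D'" and "move_C3 D D'"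
  shows "same_polys D D'"
proof -
  obtain ss x12 x13 x21 x23 x31 x32 y12 y13 y21 y23 y31 y32 where len: "length ss = 3"
    and lc: "local_change ss D D'" "tangle ss D {(x12, x21), (x13, x31), (x23, x32)} {} {}"
      "tangle ss D' {(y12, y21), (y13, y31), (y23, y32)} {} {}"
    and sub: "{x12, x13, y12, y13} \<subseteq> strand (ss ! 0)" "{x21, x23, y21, y23} \<subseteq> strand (ss ! 1)"
      "{x31, x32, y31, y32} \<subseteq> strand (ss ! 2)"
    and ord: "x12 < x13 \<longleftrightarrow> y13 < y12" "x21 < x23 \<longleftrightarrow> y23 < y21" "x31 < x32 \<longleftrightarrow> y32 < y31"
    and sgn: "crossing_sign D (x12, x21) = crossing_sign D' (y12, y21)"
      "crossing_sign D (x13, x31) = crossing_sign D' (y13, y31)"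
      "crossing_sign D (x23, x32) = crossing_sign D' (y23, y32)"
    using assms(3) unfolding move_C3_def third_move_def by (elim exE conjE) (rule that)
  obtain s1 s2 s3 where ss: "ss = [s1, s2, s3]"
    using len by (auto simp: numeral_3_eq_3 length_Suc_conv)
  have m1: "x12 \<in> strand s1" "x13 \<in> strand s1" "y12 \<in> strand s1" "y13 \<in> strand s1"
    and m2: "x21 \<in> strand s2" "x23 \<in> strand s2" "y21 \<in> strand s2" "y23 \<in> strand s2"
    and m3: "x31 \<in> strand s3" "x32 \<in> strand s3" "y31 \<in> strand s3" "y32 \<in> strand s3"
    using sub by (auto simp: ss)
  have disj: "strand s1 \<inter> strand s2 = {}" "strand s1 \<inter> strand s3 = {}" "strand s2 \<inter> strand s3 = {}"
    "strand s2 \<inter> strand s1 = {}" "strand s3 \<inter> strand s1 = {}" "strand s3 \<inter> strand s2 = {}"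
    using local_change_disjoint[OF lc(1), of 0 1] local_change_disjoint[OF lc(1), of 0 2]
      local_change_disjoint[OF lc(1), of 1 2] by (auto simp: ss)
  let ?a = "(x12, x21)" and ?b = "(x13, x31)" and ?d = "(x23, x32)"
  let ?a' = "(y12, y21)" and ?b' = "(y13, y31)" and ?d' = "(y23, y32)"
  have cr: "?a \<in> crossings D" "?b \<in> crossings D" "?d \<in> crossings D"
    "?a' \<in> crossings D'" "?b' \<in> crossings D'" "?d' \<in> crossings D'"
    using lc unfolding tangle_def by blast+
  have neq: "?a \<noteq> ?b" "?a \<noteq> ?d" "?b \<noteq> ?d" "?a' \<noteq> ?b'" "?a' \<noteq> ?d'" "?b' \<noteq> ?d'"
    using m1 m2 m3 disj by auto
  have ends: "x12 \<noteq> x13" "x21 \<noteq> x23" "x31 \<noteq> x32" "y12 \<noteq> y13" "y21 \<noteq> y23" "y31 \<noteq> y32"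
    using diagram_disjoint_ends[OF D(1) cr(1,2) neq(1)] diagram_disjoint_ends[OF D(1) cr(1,3) neq(2)]
      diagram_disjoint_ends[OF D(1) cr(2,3) neq(3)] diagram_disjoint_ends[OF D(2) cr(4,5) neq(4)]
      diagram_disjoint_ends[OF D(2) cr(4,6) neq(5)] diagram_disjoint_ends[OF D(2) cr(5,6) neq(6)]
    by simp_all
  have self: "\<not> linked ?a ?a" "\<not> linked ?b ?b" "\<not> linked ?d ?d"
    "\<not> linked ?a' ?a'" "\<not> linked ?b' ?b'" "\<not> linked ?d' ?d'"
    using cr by (auto intro!: not_linked_self dest: diagram_unit(3)[OF D(1)] diagram_unit(3)[OF D(2)])
  have sym: "linked ?b ?a = linked ?a ?b" "linked ?d ?a = linked ?a ?d" "linked ?d ?b = linked ?b ?d"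
    "linked ?b' ?a' = linked ?a' ?b'" "linked ?d' ?a' = linked ?a' ?d'" "linked ?d' ?b' = linked ?b' ?d'"
    by (rule linked_sym[OF D(1)] linked_sym[OF D(2)], (rule cr)+)+
  \<comment> \<open>The shared strand is over at both crossings for strand 1, under and then over
    for strand 2, and under at both for strand 3; hence the three forms of
    \<open>linked_flip\<close>.\<close>
  have flip: "linked ?a' ?b' = (\<not> linked ?a ?b)" "linked ?a' ?d' = (\<not> linked ?a ?d)"
    "linked ?b' ?d' = (\<not> linked ?b ?d)"
    by (rule linked_flip(1)[OF m1 m2(1,3) m3(1,3) disj(1,2,3) ord(1) ends(1,4)]
        linked_flip(2)[OF m2 m1(1,3) m3(2,4) disj(4,3,2) ord(2) ends(2,5)]
        linked_flip(3)[OF m3 m1(2,4) m2(2,4) disj(5,6,1) ord(3) ends(3,6)])+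
  show ?thesis
  proof (rule local_change_decompose[OF D lc], rule same_polysI[OF D])
    fix X0 :: "(real \<times> real) set" and B0 :: "real set"
      and lab :: "(real \<times> real) set \<Rightarrow> real \<times> real \<Rightarrow> bool"
    assume lab: "lab = odd_crossing \<or> lab = zero_label"
      and X: "crossings D = {?a, ?b, ?d} \<union> X0" "crossings D' = {?a', ?b', ?d'} \<union> X0"
        "{?a, ?b, ?d} \<inter> X0 = {}" "{?a', ?b', ?d'} \<inter> X0 = {}"
      and B: "bars D = {} \<union> B0" "bars D' = {} \<union> B0" and fin: "finite X0"
      and out: "\<And>c t. c \<in> X0 \<Longrightarrow> t \<in> set ss \<Longrightarrow> fst c \<notin> strand t \<and> snd c \<notin> strand t"
      and outB: "\<And>b t. b \<in> B0 \<Longrightarrow> t \<in> set ss \<Longrightarrow> b \<notin> strand t"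
      and sg: "\<And>c. c \<in> X0 \<Longrightarrow> crossing_sign D' c = crossing_sign D c"
    have nX: "?a \<notin> X0" "?b \<notin> X0" "?d \<notin> X0" "?a' \<notin> X0" "?b' \<notin> X0" "?d' \<notin> X0" using X by auto
    have o: "fst c \<notin> strand s1" "snd c \<notin> strand s1" "fst c \<notin> strand s2" "snd c \<notin> strand s2"
      "fst c \<notin> strand s3" "snd c \<notin> strand s3" if "c \<in> X0" for c
      using out[OF that] by (auto simp: ss)
    have oB: "b \<notin> strand s1" "b \<notin> strand s2" "b \<notin> strand s3" if "b \<in> B0" for b
      using outB[OF that] by (auto simp: ss)
    have l: "linked c ?a' = linked c ?a" "linked c ?b' = linked c ?b" "linked c ?d' = linked c ?d"
      "linked ?a' c = linked ?a c" "linked ?b' c = linked ?b c" "linked ?d' c = linked ?d c"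
      if "c \<in> X0" for c
      by (rule linked_slide[OF m1(1,3) m2(1,3) disj(1) o(1-4)[OF that]]
          linked_slide[OF m1(2,4) m3(1,3) disj(2) o(1,2,5,6)[OF that]]
          linked_slide[OF m2(2,4) m3(2,4) disj(3) o(3-6)[OF that]])+
    \<comment> \<open>Sliding ends along the strands turns the three chords into the sides of a
      triangle with vertices \<open>x12\<close>, \<open>x21\<close>, \<open>x31\<close>, one on each
      strand, to which \<open>on_arc_triangle\<close> applies.\<close>
    have tri: "linked ?a c = (linked ?b c \<noteq> linked ?d c)" if "c \<in> X0" for c
    proof -
      have "linked ?b c = linked (x12, x31) c" "linked ?d c = linked (x21, x31) c"
        by (rule linked_slide(2)[OF m1(1,2) m3(1,1) disj(2) o(1,2,5,6)[OF that]]
            linked_slide(2)[OF m2(1,2) m3(1,2) disj(3) o(3-6)[OF that]])+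
      moreover have "x12 \<noteq> x21" "x12 \<noteq> x31" "x21 \<noteq> x31" using m1 m2 m3 disj by auto
      then have "(on_arc x12 x21 u \<noteq> (on_arc x12 x31 u \<noteq> on_arc x21 x31 u)) \<longleftrightarrow>
        (on_arc x12 x21 v \<noteq> (on_arc x12 x31 v \<noteq> on_arc x21 x31 v))" if "u = fst c" "v = snd c" for u v
        using m1 m2 m3 o[OF \<open>c \<in> X0\<close>] that by (intro on_arc_triangle) auto
      ultimately show ?thesis by (auto simp: linked_def)
    qed
    note labels = triangle_labels[OF fin nX(1-3) neq(1-3) nX(4-6) neq(4-6) self sym flip l tri lab]
    have w: "weight B0 i ?a' = weight B0 i ?a" "weight B0 i ?b' = weight B0 i ?b"
      "weight B0 i ?d' = weight B0 i ?d" for i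
      by (rule weight_slide[OF m1(1,3) m2(1,3) disj(1) oB(1,2)]
          weight_slide[OF m1(2,4) m3(1,3) disj(2) oB(1,3)]
          weight_slide[OF m2(2,4) m3(2,4) disj(3) oB(2,3)], assumption, assumption)+
    show "gauss_poly lab (crossings D) (bars D) (crossing_sign D) =
      gauss_poly lab (crossings D') (bars D') (crossing_sign D')"
      unfolding gauss_poly_def X B Un_insert_left Un_empty_left
      by (rule sum_insert3_eq[OF fin nX(1-3) neq(1-3) nX(4-6) neq(4-6)])
        (simp_all only: labels w sgn sg)
  qed
qed

section \<open>Invariance under equivalence of diagrams\<close>

lemma diagram_step_same_polys:
  assumes "diagram_step D D'"
  shows "same_polys D D'"
proof -
  have D: "is_diagram D" "is_diagram D'" using assms unfolding diagram_step_def by simp_all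
  note step = planar_isotopic_same_polys[OF D] move_C1_same_polys[OF D] 
    move_C2_same_polys[OF D] move_C3_same_polys[OF D] move_V1_same_polys[OF D] 
    move_V2_same_polys[OF D] move_V3_same_polys[OF D] move_V4_same_polys[OF D] 
    move_T1_same_polys[OF D] move_T2_same_polys[OF D] move_T3_same_polys[OF D]
  show ?thesis
    using assms unfolding diagram_step_def by (elim conjE disjE) (erule step)+
qed

lemma diagram_equiv_same_polys:
  assumes "(D, D') \<in> diagram_equiv"
  shows "Q_poly D = Q_poly D'" "Qz_poly D = Qz_poly D'"
proof -
  have "equivclp diagram_step D D'" using assms by (simp add: diagram_equiv_def)
  then have "same_polys D D'"
  proof (induction rule: equivclp_induct)
    case base
    show ?case by (simp add: same_polys_def)
  next
    case (step y z)
    then show ?case using diagram_step_same_polys unfolding same_polys_def by metis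
  qed
  then show "Q_poly D = Q_poly D'" "Qz_poly D = Qz_poly D'" by (simp_all add: same_polys_def)
qed


section \<open>A family of rosettes\<close>

text \<open>A closed curve in polar form: three turns, with a radius oscillating
  \<open>3 * k + 1\<close> times. The constant 2 keeps the radius positive, so a point determines
  radius and direction.\<close>

definition rosette :: "nat \<Rightarrow> real \<Rightarrow> complex" where
  "rosette k t = (2 + cos (2 * pi * ((3 * real k + 1) * t))) *\<^sub>R cis (6 * pi * t)"

text \<open>The first factor is the velocity in the rotating frame, with radial part
  \<open>r'\<close> and angular part \<open>r\<close> times the angular speed \<open>6 * pi\<close>.
  At a double point both passages have the same frame, so only these components have to be
  compared.\<close>

definition velocity :: "nat \<Rightarrow> real \<Rightarrow> complex" where
  "velocity k t = Complex (- (2 * pi * (3 * real k + 1)) * sin (2 * pi * ((3 * real k + 1) * t)))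
     (6 * pi * (2 + cos (2 * pi * ((3 * real k + 1) * t)))) * cis (6 * pi * t)"

lemma rosette_has_velocity: "(rosette k has_vector_derivative velocity k t) (at t)"
  unfolding rosette_def[abs_def] velocity_def has_vector_derivative_def
  by (auto intro!: derivative_eq_intros simp: complex_eq_iff fun_eq_iff algebra_simps)

lemma rosette_C1: "rosette k C1_differentiable_on UNIV"
proof -
  have "continuous_on UNIV (velocity k)"
    unfolding velocity_def[abs_def] Complex_eq by (intro continuous_intros)
  then show ?thesis unfolding C1_differentiable_on_def using rosette_has_velocity by blast
qed

lemma rosette_radius_pos: "2 + cos x > (0 :: real)"
  using cos_ge_minus_one[of x] by linarith

lemma velocity_neq_0: "velocity k t \<noteq> 0"
proof -
  have "6 * pi * (2 + cos (2 * pi * ((3 * real k + 1) * t))) \<noteq> 0"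
    using rosette_radius_pos[of "2 * pi * ((3 * real k + 1) * t)"] by simp
  then show ?thesis
    unfolding velocity_def by (metis cis_neq_zero complex.sel(2) mult_eq_0_iff zero_complex.sel(2))
qed

lemma rosette_periodic: "rosette k (t + 1) = rosette k t"
proof -
  have "cos (2 * pi * ((3 * real k + 1) * (t + 1))) = cos (2 * pi * ((3 * real k + 1) * t))"
    unfolding cos_eq by (intro bexI[of _ "of_nat (3 * k + 1)"]) (simp_all add: algebra_simps)
  moreover have "cis (6 * pi * (t + 1)) = cis (6 * pi * t)"
    using cis_multiple_2pi[of 3] cis_mult[of "6 * pi * t" "6 * pi"] by (simp add: algebra_simps)
  ultimately show ?thesis by (simp add: rosette_def)
qed

section \<open>Double points and transversality of the rosette\<close>

lemma cis_eq_iff_Ints: "cis (2 * pi * a) = cis (2 * pi * b) \<longleftrightarrow> a - b \<in> \<int>"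
proof -
  have "cis (2 * pi * a) = cis (2 * pi * b) \<longleftrightarrow> (\<exists>n::int. 2 * pi * a = 2 * pi * b + 2 * pi * n)"
    unfolding sin_cos_eq_iff[symmetric] by (auto simp: complex_eq_iff)
  also have "\<dots> \<longleftrightarrow> (\<exists>n::int. a - b = n)"
  proof (rule ex_cong1)
    fix n :: int
    have "2 * pi * a = 2 * pi * b + 2 * pi * n \<longleftrightarrow> (2 * pi) * (a - b) = (2 * pi) * n"
      by (auto simp: algebra_simps)
    then show "2 * pi * a = 2 * pi * b + 2 * pi * n \<longleftrightarrow> a - b = n" by simp
  qed
  finally show ?thesis by (auto elim: Ints_cases)
qed

lemma cos_eq_iff_Ints: "cos (2 * pi * a) = cos (2 * pi * b) \<longleftrightarrow> a - b \<in> \<int> \<or> a + b \<in> \<int>"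
proof -
  have "(2 * pi * a = 2 * pi * b + 2 * n * pi \<or> 2 * pi * a = - (2 * pi * b) + 2 * n * pi)
    \<longleftrightarrow> a - b = n \<or> a + b = n" for n
  proof -
    have "2 * pi * a = 2 * pi * b + 2 * n * pi \<longleftrightarrow> (2 * pi) * (a - b) = (2 * pi) * n"
      "2 * pi * a = - (2 * pi * b) + 2 * n * pi \<longleftrightarrow> (2 * pi) * (a + b) = (2 * pi) * n"
      by (auto simp: algebra_simps)
    then show ?thesis by simp
  qed
  then show ?thesis unfolding cos_eq by auto
qed

lemma unit_interval_eqI:
  fixes t u :: real
  assumes "t - u \<in> \<int>" "t \<in> {0..<1}" "u \<in> {0..<1}"
  shows "t = u"
proof -
  obtain m :: int where m: "t - u = m" using assms(1) by (elim Ints_cases)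
  then have "\<bar>real_of_int m\<bar> < 1" using assms(2,3) unfolding atLeastLessThan_iff by linarith
  then have "m = 0" by linarith
  then show ?thesis using m by simp
qed

text \<open>Equal directions give the first condition. Equal radii give that \<open>n\<close> times
  the difference or \<open>n\<close> times the sum of the parameters is an integer, where
  \<open>n = 3 * k + 1\<close>; the difference is ruled out since \<open>n - 3 * k = 1\<close> would
  make \<open>t - u\<close> itself an integer.\<close>

lemma rosette_double_point:
  assumes t: "t \<in> {0..<1}" and u: "u \<in> {0..<1}" and neq: "t \<noteq> u"
  shows "rosette k t = rosette k u \<longleftrightarrow> 3 * (t - u) \<in> \<int> \<and> (3 * real k + 1) * (t + u) \<in> \<int>"
proof -
  let ?n = "3 * real k + 1"
  let ?r = "\<lambda>t. 2 + cos (2 * pi * (?n * t))"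
  have cis: "cis (6 * pi * t) = cis (6 * pi * u) \<longleftrightarrow> 3 * (t - u) \<in> \<int>"
    using cis_eq_iff_Ints[of "3 * t" "3 * u"] by (simp add: algebra_simps)
  have cos: "?r t = ?r u \<longleftrightarrow> ?n * (t - u) \<in> \<int> \<or> ?n * (t + u) \<in> \<int>"
    using cos_eq_iff_Ints[of "?n * t" "?n * u"] by (simp add: algebra_simps)
  have no: "\<not> (3 * (t - u) \<in> \<int> \<and> ?n * (t - u) \<in> \<int>)"
  proof
    assume a: "3 * (t - u) \<in> \<int> \<and> ?n * (t - u) \<in> \<int>"
    have "?n * (t - u) - real k * (3 * (t - u)) \<in> \<int>"
      by (rule Ints_diff[OF conjunct2[OF a] Ints_mult[OF Ints_of_nat conjunct1[OF a]]])
    then have "t - u \<in> \<int>" by (simp add: algebra_simps)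
    then show False using unit_interval_eqI t u neq by blast
  qed
  have "rosette k t = rosette k u \<longleftrightarrow> ?r t = ?r u \<and> cis (6 * pi * t) = cis (6 * pi * u)"
  proof
    assume eq: "rosette k t = rosette k u"
    have norm: "norm (rosette k t) = ?r t" for t
      using rosette_radius_pos[of "2 * pi * (?n * t)"] by (simp add: rosette_def)
    have "?r t = ?r u" using eq norm by metis
    then show "?r t = ?r u \<and> cis (6 * pi * t) = cis (6 * pi * u)"
      using eq rosette_radius_pos[of "2 * pi * (?n * u)"] by (simp add: rosette_def)
  qed (simp add: rosette_def)
  then show ?thesis using cis cos no by blast
qed

lemma plane_det_mult_right: "plane_det (v * z) (w * z) = (norm z)\<^sup>2 * plane_det v w"
  unfolding plane_det_def cmod_power2 by (simp add: power2_eq_square algebra_simps)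

lemma plane_det_reflect:
  "plane_det (Complex (- a * s) b * z) (Complex (- a * - s) b * z) = - 2 * (a * (s * b)) * (norm z)\<^sup>2"
  unfolding plane_det_mult_right by (simp add: plane_det_def)

text \<open>The two passages have the same angular velocity and opposite radial velocities, so
  tangency would require the radial velocity to vanish.\<close>

lemma rosette_transverse:
  assumes t: "t \<in> {0..<1}" and u: "u \<in> {0..<1}" and neq: "t \<noteq> u" and eq: "rosette k t = rosette k u"
  shows "plane_det (velocity k t) (velocity k u) \<noteq> 0"
proof -
  let ?n = "3 * real k + 1"
  have I: "3 * (t - u) \<in> \<int>" "?n * (t + u) \<in> \<int>"
    using rosette_double_point[OF t u neq, of k] eq by auto
  have cis: "cis (6 * pi * u) = cis (6 * pi * t)"
    using cis_eq_iff_Ints[of "3 * t" "3 * u"] I(1) by (simp add: algebra_simps)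
  have cos: "cos (2 * pi * (?n * u)) = cos (2 * pi * (?n * t))"
    using cos_eq_iff_Ints[of "?n * t" "?n * u"] I(2) by (simp add: algebra_simps)
  have sin: "sin (2 * pi * (?n * u)) = - sin (2 * pi * (?n * t))"
  proof -
    obtain m :: int where "?n * (t + u) = m" using I(2) by (auto elim: Ints_cases)
    then have "?n * u = m - ?n * t" by (simp add: algebra_simps)
    then have "2 * pi * (?n * u) = 2 * pi * (m - ?n * t)" by simp
    then have "2 * pi * (?n * u) = - (2 * pi * (?n * t)) + 2 * pi * m"
      by (simp only: right_diff_distrib)
    then show ?thesis using sin_cos_eq_iff by (metis sin_minus)
  qed
  have "sin (2 * pi * (?n * t)) \<noteq> 0"
  proof
    assume z: "sin (2 * pi * (?n * t)) = 0"
    have "2 * (?n * t) \<in> \<int>" "2 * (?n * u) \<in> \<int>"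
      using z sin sin_times_pi_eq_0[of "2 * (?n * t)"] sin_times_pi_eq_0[of "2 * (?n * u)"]
      by (simp_all add: algebra_simps)
    moreover have "2 * real k + 1 \<in> \<int>" by simp
    \<comment> \<open>The coefficients come from
      \<open>3 * (2 * k + 1) - 2 * (3 * k + 1) = 1\<close>, so the combination equals
      \<open>t - u\<close>.\<close>
    ultimately have "(2 * real k + 1) * (3 * (t - u)) - (2 * (?n * t) - 2 * (?n * u)) \<in> \<int>"
      using I(1) by (metis Ints_diff Ints_mult)
    then have "t - u \<in> \<int>" by (simp add: algebra_simps)
    then show False using unit_interval_eqI t u neq by blast
  qed
  moreover have "pi \<noteq> 0" "2 + cos (2 * pi * (?n * t)) \<noteq> 0" "?n \<noteq> 0"
    using rosette_radius_pos[of "2 * pi * (?n * t)"] by auto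
  ultimately show ?thesis
    unfolding velocity_def cis cos sin plane_det_reflect norm_cis by (simp only: mult_eq_0_iff) simp
qed

section \<open>The diagrams of the family and their chords\<close>

definition chord :: "nat \<Rightarrow> nat \<Rightarrow> real \<times> real" where
  "chord k j = (real j / (6 * real k + 2) - 1 / 6, real j / (6 * real k + 2) + 1 / 6)"

text \<open>Exchanging over and under negates the determinant. Choosing the over-strand by its sign
  makes the crossing positive without evaluating any sine, and linking does not see the
  choice.\<close>

definition positive_crossing :: "nat \<Rightarrow> nat \<Rightarrow> real \<times> real" where
  "positive_crossing k j =
     (if plane_det (velocity k (fst (chord k j))) (velocity k (snd (chord k j))) > 0
      then chord k j else prod.swap (chord k j))"

definition rosette_crossing :: "nat \<Rightarrow> nat \<Rightarrow> real \<times> real" where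
  "rosette_crossing k j =
     (if j = 5 * k then prod.swap (positive_crossing k j) else positive_crossing k j)"

definition rosette_indices :: "nat \<Rightarrow> nat set" where
  "rosette_indices k = {k + 1..2 * k} \<union> {3 * k, 5 * k}"

definition rosette_diagram :: "nat \<Rightarrow> diagram" where
  "rosette_diagram k =
     \<lparr>curve = rosette k, crossings = rosette_crossing k ` rosette_indices k, bars = {}\<rparr>"

lemma rosette_diagram_simps [simp]:
  "curve (rosette_diagram k) = rosette k"
  "crossings (rosette_diagram k) = rosette_crossing k ` rosette_indices k"
  "bars (rosette_diagram k) = {}"
  by (simp_all add: rosette_diagram_def)

lemma tangent_rosette_diagram [simp]: "tangent (rosette_diagram k) t = velocity k t"
  unfolding tangent_def rosette_diagram_simps by (rule vector_derivative_at[OF rosette_has_velocity])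

lemma double_points_rosette_diagram:
  "(t, u) \<in> double_points (rosette_diagram k) \<longleftrightarrow>
    t \<in> {0..<1} \<and> u \<in> {0..<1} \<and> t \<noteq> u \<and> 3 * (t - u) \<in> \<int> \<and> (3 * real k + 1) * (t + u) \<in> \<int>"
  unfolding double_points_def using rosette_double_point[of t u k] by auto

lemma double_point_transverse:
  assumes "(t, u) \<in> double_points (rosette_diagram k)"
  shows "plane_det (velocity k t) (velocity k u) \<noteq> 0"
  using assms rosette_transverse[of t u k] by (simp add: double_points_def)

text \<open>The chord solves \<open>3 * (t - u) = -1\<close> and
  \<open>(3 * k + 1) * (t + u) = j\<close>. The bounds on \<open>j\<close> keep its centre strictly
  between 1/6 and 5/6, so that the chord does not run across the base point.\<close>

lemma chord_double_point:
  assumes "k < j" "j \<le> 5 * k"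
  shows "chord k j \<in> double_points (rosette_diagram k)"
proof -
  define c where "c = real j / (6 * real k + 2)"
  have "real j \<ge> real k + 1" "real j \<le> 5 * real k" using assms by linarith+
  then have "1 / 6 < c" "c < 5 / 6" unfolding c_def by (simp_all add: field_simps)
  moreover have "(6 * real k + 2) * c = real j" unfolding c_def by (simp add: add_nonneg_eq_0_iff)
  then have "(3 * real k + 1) * (c - 1 / 6 + (c + 1 / 6)) = real j" by (simp add: algebra_simps)
  moreover have "3 * (c - 1 / 6 - (c + 1 / 6)) = - 1" by simp
  ultimately show ?thesis unfolding chord_def double_points_rosette_diagram c_def[symmetric] by auto
qed

lemma rosette_crossing_chord: "rosette_crossing k j \<in> {chord k j, prod.swap (chord k j)}"
  by (auto simp: rosette_crossing_def positive_crossing_def)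

lemma rosette_indices_bounds: "k \<ge> 1 \<Longrightarrow> j \<in> rosette_indices k \<Longrightarrow> k < j \<and> j \<le> 5 * k"
  by (auto simp: rosette_indices_def)

text \<open>The sum of the two parameters ignores their order and determines the index. This yields
  injectivity and also that no crossing occurs in both orders.\<close>

lemma rosette_crossing_index:
  assumes "fst (rosette_crossing k i) + snd (rosette_crossing k i)
    = fst (rosette_crossing k j) + snd (rosette_crossing k j)"
  shows "i = j"
proof -
  have "fst (rosette_crossing k j) + snd (rosette_crossing k j) = 2 * (real j / (6 * real k + 2))" for j
    using rosette_crossing_chord[of k j] by (auto simp: chord_def)
  then have "real i / (6 * real k + 2) = real j / (6 * real k + 2)"
    using assms by (metis mult_cancel_left zero_neq_numeral)
  then show ?thesis by (simp add: field_simps)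
qed

lemma inj_rosette_crossing: "inj (rosette_crossing k)"
  using rosette_crossing_index by (metis injI)

lemma finite_double_points_rosette: "finite (double_points (rosette_diagram k))"
proof -
  let ?n = "3 * real k + 1"
  let ?f = "\<lambda>(a::int, b::int). ((b / ?n + a / 3) / 2, (b / ?n - a / 3) / 2)"
  \<comment> \<open>A double point is recovered from the integers \<open>a = 3 * (t - u)\<close> and
    \<open>b = ?n * (t + u)\<close>, which are bounded as \<open>t\<close> and \<open>u\<close> lie
    in the unit interval.\<close>
  have "double_points (rosette_diagram k) \<subseteq> ?f ` ({-3..3} \<times> {0..6 * int k + 2})"
  proof
    fix c assume "c \<in> double_points (rosette_diagram k)"
    then obtain t u where c: "c = (t, u)" and dp: "(t, u) \<in> double_points (rosette_diagram k)"
      by (cases c) auto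
    obtain a b :: int where a: "3 * (t - u) = a" and b: "?n * (t + u) = b"
      using dp unfolding double_points_rosette_diagram by (auto elim!: Ints_cases)
    have tu: "0 \<le> t" "t < 1" "0 \<le> u" "u < 1" using dp unfolding double_points_rosette_diagram by auto
    have "\<bar>real_of_int a\<bar> \<le> 3" unfolding a[symmetric] using tu by auto
    then have a_range: "a \<in> {-3..3}" by auto
    have "0 \<le> ?n * (t + u)" "?n * (t + u) \<le> ?n * 2"
      using tu by (intro mult_nonneg_nonneg mult_left_mono; simp)+
    then have "0 \<le> real_of_int b" "real_of_int b \<le> real_of_int (6 * int k + 2)"
      unfolding b by (simp_all add: algebra_simps)
    then have b_range: "b \<in> {0..6 * int k + 2}" by (simp only: atLeastAtMost_iff of_int_le_iff of_int_0_le_iff)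
    have cancel: "?n * (t + u) / ?n = t + u" "3 * (t - u) / 3 = t - u"
      by (rule nonzero_mult_div_cancel_left; simp add: add_nonneg_eq_0_iff)+
    have "c = ?f (a, b)" unfolding c a[symmetric] b[symmetric] prod.case cancel by simp
    then show "c \<in> ?f ` ({-3..3} \<times> {0..6 * int k + 2})" using a_range b_range by blast
  qed
  then show ?thesis by (rule finite_subset) auto
qed

lemma is_diagram_rosette:
  assumes "k \<ge> 1"
  shows "is_diagram (rosette_diagram k)"
proof -
  let ?D = "rosette_diagram k"
  have "u = v" if "(t, u) \<in> double_points ?D" "(t, v) \<in> double_points ?D" for t u v
  proof -
    have I: "3 * (t - u) \<in> \<int>" "(3 * real k + 1) * (t + u) \<in> \<int>" "3 * (t - v) \<in> \<int>"
      "(3 * real k + 1) * (t + v) \<in> \<int>" and uv: "u \<in> {0..<1}" "v \<in> {0..<1}"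
      using that unfolding double_points_rosette_diagram by auto
    \<comment> \<open>Again by \<open>n - 3 * k = 1\<close>, this combination equals
      \<open>u - v\<close>.\<close>
    have "(3 * real k + 1) * (t + u) - (3 * real k + 1) * (t + v)
      - real k * (3 * (t - v) - 3 * (t - u)) \<in> \<int>"
      by (rule Ints_diff[OF Ints_diff[OF I(2,4)] Ints_mult[OF Ints_of_nat Ints_diff[OF I(3,1)]]])
    then have "u - v \<in> \<int>" by (simp add: algebra_simps)
    then show "u = v" using unit_interval_eqI uv by blast
  qed
  moreover note double_point_transverse[of _ _ k]
  moreover have sub: "crossings ?D \<subseteq> double_points ?D"
  proof
    fix c assume "c \<in> crossings ?D"
    then obtain j where j: "j \<in> rosette_indices k" "c = rosette_crossing k j" by auto
    have "chord k j \<in> double_points ?D"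
      using rosette_indices_bounds[OF assms j(1)] by (intro chord_double_point) auto
    then show "c \<in> double_points ?D"
      using rosette_crossing_chord[of k j] double_points_sym[of "fst (chord k j)" "snd (chord k j)"]
      by (auto simp: j prod.swap_def)
  qed
  moreover have "crossings ?D \<inter> (crossings ?D)\<inverse> = {}"
  proof (rule equals0I)
    fix c assume "c \<in> crossings ?D \<inter> (crossings ?D)\<inverse>"
    then have cD: "c \<in> crossings ?D" "prod.swap c \<in> crossings ?D" by (cases c; simp)+
    obtain i j where i: "c = rosette_crossing k i" and j: "prod.swap c = rosette_crossing k j"
      using cD unfolding rosette_diagram_simps by blast
    have c: "c \<in> double_points ?D" using cD(1) sub by blast
    have "i = j"
      by (rule rosette_crossing_index[of k]) (simp add: i[symmetric] j[symmetric])
    then have "prod.swap c = c" using i j by simp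
    then have "fst c = snd c" by (metis fst_swap)
    moreover have "(fst c, snd c) \<in> double_points ?D" using c by simp
    ultimately show False unfolding double_points_rosette_diagram by blast
  qed
  ultimately show ?thesis
    unfolding is_diagram_def tangent_rosette_diagram
    using finite_double_points_rosette[of k] rosette_periodic[of k] rosette_C1[of k] velocity_neq_0[of k]
    by (auto simp del: rosette_diagram_simps(2))
qed

lemma crossing_sign_positive_crossing:
  assumes "k < j" "j \<le> 5 * k"
  shows "crossing_sign (rosette_diagram k) (positive_crossing k j) = 1"
    and "crossing_sign (rosette_diagram k) (prod.swap (positive_crossing k j)) = -1"
proof -
  let ?d = "\<lambda>c. plane_det (velocity k (fst c)) (velocity k (snd c))"
  have swap: "?d (prod.swap c) = - ?d c" for c by (simp add: plane_det_def)
  have "(fst (chord k j), snd (chord k j)) \<in> double_points (rosette_diagram k)"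
    using chord_double_point[OF assms] by simp
  then have "?d (chord k j) \<noteq> 0"
    by (rule double_point_transverse)
  then have "?d (positive_crossing k j) > 0" using swap by (auto simp: positive_crossing_def)
  then show "crossing_sign (rosette_diagram k) (positive_crossing k j) = 1"
    and "crossing_sign (rosette_diagram k) (prod.swap (positive_crossing k j)) = -1"
    using swap[of "positive_crossing k j"] by (simp_all add: crossing_sign_def)
qed

lemma crossing_sign_rosette_crossing:
  assumes "k < j" "j \<le> 5 * k"
  shows "crossing_sign (rosette_diagram k) (rosette_crossing k j) = (if j = 5 * k then -1 else 1)"
  using crossing_sign_positive_crossing[OF assms] by (cases "j = 5 * k") (simp_all add: rosette_crossing_def)

text \<open>All chords have length 1/3, so two of them interlace iff their distinct centres are less
  than 1/3 apart, that is, iff three times the difference of the indices is below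
  \<open>6 * k + 2\<close>.\<close>

lemma linked_chords:
  assumes "i \<noteq> j"
  shows "linked (chord k i) (chord k j) \<longleftrightarrow> i \<le> j + 2 * k \<and> j \<le> i + 2 * k"
    and "fst (chord k j) \<notin> {fst (chord k i), snd (chord k i)}"
    and "snd (chord k j) \<notin> {fst (chord k i), snd (chord k i)}"
proof -
  define m where "m = 6 * real k + 2"
  let ?c = "\<lambda>j. real j / m"
  have m: "m > 0" by (simp add: m_def)
  have neq: "?c i \<noteq> ?c j" using assms m by simp
  have close: "?c a < ?c b + 1 / 3 \<longleftrightarrow> a \<le> b + 2 * k" for a b
  proof -
    have "?c a < ?c b + 1 / 3 \<longleftrightarrow> 3 * real a < 3 * real b + m" using m by (simp add: field_simps)
    also have "\<dots> \<longleftrightarrow> a \<le> b + 2 * k" unfolding m_def by linarith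
    finally show ?thesis .
  qed
  \<comment> \<open>Chords with a common end would give an equation that fails modulo 3.\<close>
  have far: "?c a \<noteq> ?c b + 1 / 3" for a b
  proof
    assume "?c a = ?c b + 1 / 3"
    then have "3 * real a = 3 * real b + m" using m by (simp add: field_simps)
    then have "3 * a = 3 * b + (6 * k + 2)" unfolding m_def by linarith
    then show False by presburger
  qed
  show "linked (chord k i) (chord k j) \<longleftrightarrow> i \<le> j + 2 * k \<and> j \<le> i + 2 * k"
    unfolding close[symmetric] using neq far[of i j] far[of j i]
    unfolding linked_def chord_def m_def[symmetric] fst_conv snd_conv on_arc_iff by argo
  show "fst (chord k j) \<notin> {fst (chord k i), snd (chord k i)}"
    "snd (chord k j) \<notin> {fst (chord k i), snd (chord k i)}"
    using neq far[of i j] far[of j i] unfolding chord_def m_def[symmetric] fst_conv snd_conv insert_iff empty_iff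
    by argo+
qed

lemma linked_rosette_crossings:
  "linked (rosette_crossing k i) (rosette_crossing k j) \<longleftrightarrow>
    i \<noteq> j \<and> i \<le> j + 2 * k \<and> j \<le> i + 2 * k"
proof (cases "i = j")
  case True
  have "fst (rosette_crossing k j) \<noteq> snd (rosette_crossing k j)"
    using rosette_crossing_chord[of k j] by (auto simp: chord_def)
  then show ?thesis using True by (simp add: linked_def)
next
  case False
  have "linked (rosette_crossing k i) (rosette_crossing k j) = linked (rosette_crossing k i) (chord k j)"
    using rosette_crossing_chord[of k j] by (metis insertE linked_swap_right singletonD)
  also have "\<dots> = linked (chord k i) (chord k j)"
  proof -
    have "linked (prod.swap (chord k i)) (chord k j) = linked (chord k i) (chord k j)"
      by (rule linked_swap_left[OF _ linked_chords(2,3)[OF False]]) (simp add: chord_def)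
    then show ?thesis using rosette_crossing_chord[of k i] by auto
  qed
  finally show ?thesis using linked_chords(1)[OF False] False by simp
qed

section \<open>Parities and polynomials of the family\<close>

lemma finite_rosette_indices: "finite (rosette_indices k)"
  by (simp add: rosette_indices_def)

lemma link_parity_rosette:
  "link_parity (rosette_crossing k ` rosette_indices k) P (rosette_crossing k i) \<longleftrightarrow>
    odd (card {j \<in> rosette_indices k. i \<noteq> j \<and> i \<le> j + 2 * k \<and> j \<le> i + 2 * k \<and> P (rosette_crossing k j)})"
  unfolding link_parity_def sum.reindex[OF inj_on_subset[OF inj_rosette_crossing subset_UNIV]] o_def
    linked_rosette_crossings
  using finite_rosette_indices[of k] by (simp add: Int_def)

text \<open>The distance from \<open>3 * k\<close> to \<open>5 * k\<close> is exactly the largest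
  one allowing a link, while the indices up to \<open>2 * k\<close> are at least
  \<open>3 * k\<close> away from \<open>5 * k\<close>. Since \<open>k\<close> is even, the numbers
  of neighbours are \<open>k\<close>, \<open>k + 1\<close> and 1.\<close>

lemma odd_rosette_crossing:
  assumes k: "even k" "k \<ge> 2" and i: "i \<in> rosette_indices k"
  shows "odd_crossing (rosette_crossing k ` rosette_indices k) (rosette_crossing k i) \<longleftrightarrow>
    i = 3 * k \<or> i = 5 * k"
proof -
  let ?N = "{j \<in> rosette_indices k. i \<noteq> j \<and> i \<le> j + 2 * k \<and> j \<le> i + 2 * k}"
  have "odd (card ?N) \<longleftrightarrow> i = 3 * k \<or> i = 5 * k"
  proof -
    consider (M) "i \<in> {k + 1..2 * k}" | (v) "i = 3 * k" | (w) "i = 5 * k"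
      using i by (auto simp: rosette_indices_def)
    then show ?thesis
    proof cases
      case M
      then have "?N = insert (3 * k) ({k + 1..2 * k} - {i})" using k by (auto simp: rosette_indices_def)
      then have "card ?N = k" using M k by simp
      then show ?thesis using M k by auto
    next
      case v
      then have "?N = insert (5 * k) {k + 1..2 * k}" using k by (auto simp: rosette_indices_def)
      then have "card ?N = k + 1" using k by simp
      then show ?thesis using v k by simp
    next
      case w
      then have "?N = {3 * k}" using k by (auto simp: rosette_indices_def)
      then show ?thesis using w by simp
    qed
  qed
  then show ?thesis unfolding odd_crossing_def link_parity_rosette by simp
qed

lemma zero_label_rosette_crossing:
  assumes k: "even k" "k \<ge> 2" and i: "i \<in> rosette_indices k"
  shows "zero_label (rosette_crossing k ` rosette_indices k) (rosette_crossing k i)"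
proof (cases "i = 3 * k \<or> i = 5 * k")
  case True
  then show ?thesis using odd_rosette_crossing[OF assms] by (simp add: zero_label_def)
next
  case False
  let ?X = "rosette_crossing k ` rosette_indices k"
  have M: "i \<in> {k + 1..2 * k}" using i False by (auto simp: rosette_indices_def)
  have "{j \<in> rosette_indices k. i \<noteq> j \<and> i \<le> j + 2 * k \<and> j \<le> i + 2 * k \<and>
      \<not> odd_crossing ?X (rosette_crossing k j)}
    = {j \<in> rosette_indices k. i \<noteq> j \<and> i \<le> j + 2 * k \<and> j \<le> i + 2 * k \<and> \<not> (j = 3 * k \<or> j = 5 * k)}"
    using odd_rosette_crossing[OF k] by blast
  \<comment> \<open>The neighbour \<open>3 * k\<close> is odd and drops out of the zero
    index.\<close>
  also have "\<dots> = {k + 1..2 * k} - {i}" using M k by (auto simp: rosette_indices_def)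
  finally have "link_parity ?X (\<lambda>g. \<not> odd_crossing ?X g) (rosette_crossing k i)"
    unfolding link_parity_rosette using M k by simp
  then show ?thesis by (simp add: zero_label_def)
qed

lemma weight_no_bars: "weight {} i c = (if i then (var_s - 1)\<^sup>2 else 0)"
  by (simp add: weight_def bar_odd_def power2_eq_square)

lemma gauss_poly_rosette:
  assumes k: "k \<ge> 1"
    and lab: "\<And>j. j \<in> rosette_indices k \<Longrightarrow>
      lab (rosette_crossing k ` rosette_indices k) (rosette_crossing k j) = L j"
  shows "gauss_poly lab (rosette_crossing k ` rosette_indices k) {} (crossing_sign (rosette_diagram k))
    = (\<Sum>j\<in>rosette_indices k. of_int (if j = 5 * k then -1 else 1) * (if L j then (var_s - 1)\<^sup>2 else 0))"
  unfolding gauss_poly_def sum.reindex[OF inj_on_subset[OF inj_rosette_crossing subset_UNIV]]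
    o_def weight_no_bars
  by (rule sum.cong[OF refl])
    (simp only: lab crossing_sign_rosette_crossing rosette_indices_bounds[OF k])

lemma sum_rosette_indices:
  assumes "k \<ge> 1"
  shows "sum f (rosette_indices k) = sum f {k + 1..2 * k} + (f (3 * k) + f (5 * k))"
  unfolding rosette_indices_def using assms by (subst sum.union_disjoint) auto

lemma Q_poly_rosette:
  assumes k: "even k" "k \<ge> 2"
  shows "Q_poly (rosette_diagram k) = 0"
proof -
  let ?f = "\<lambda>j. of_int (if j = 5 * k then -1 else 1) *
    (if j = 3 * k \<or> j = 5 * k then (var_s - 1)\<^sup>2 else 0)"
  have k1: "k \<ge> 1" using k by simp
  have "Q_poly (rosette_diagram k) = sum ?f (rosette_indices k)"
    unfolding Q_poly_eq[OF is_diagram_rosette[OF k1]] rosette_diagram_simps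
    by (rule gauss_poly_rosette[OF k1]) (rule odd_rosette_crossing[OF k])
  also have "\<dots> = sum ?f {k + 1..2 * k} + (?f (3 * k) + ?f (5 * k))"
    by (rule sum_rosette_indices[OF k1])
  also have "sum ?f {k + 1..2 * k} = 0" by (rule sum.neutral) (use k in auto)
  also have "?f (3 * k) + ?f (5 * k) = 0" using k by simp
  finally show ?thesis by simp
qed

lemma Qz_poly_rosette:
  assumes k: "even k" "k \<ge> 2"
  shows "Qz_poly (rosette_diagram k) = of_nat k * (var_s - 1)\<^sup>2"
proof -
  let ?f = "\<lambda>j. of_int (if j = 5 * k then -1 else 1) * (if True then (var_s - 1)\<^sup>2 else 0)"
  have k1: "k \<ge> 1" using k by simp
  have "Qz_poly (rosette_diagram k) = sum ?f (rosette_indices k)"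
    unfolding Qz_poly_eq[OF is_diagram_rosette[OF k1]] rosette_diagram_simps
    by (rule gauss_poly_rosette[OF k1]) (simp only: zero_label_rosette_crossing[OF k])
  also have "\<dots> = sum ?f {k + 1..2 * k} + (?f (3 * k) + ?f (5 * k))"
    by (rule sum_rosette_indices[OF k1])
  also have "sum ?f {k + 1..2 * k} = (\<Sum>j\<in>{k + 1..2 * k}. (var_s - 1)\<^sup>2)"
    by (rule sum.cong) (use k in auto)
  also have "?f (3 * k) + ?f (5 * k) = 0" using k by simp
  finally show ?thesis by simp
qed

lemma var_s_minus_1_neq_0: "(var_s - 1)\<^sup>2 \<noteq> 0"
  by (simp add: var_s_def one_pCons)

theorem mainTheorem2:
  shows "\<exists>T :: nat \<Rightarrow> diagram set.
    (\<forall>n. T n \<in> twisted_knots) \<and>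
    (\<forall>n m. \<forall>D\<in>T n. \<forall>D'\<in>T m. Q_poly D = Q_poly D') \<and>
    (\<forall>n m. n \<noteq> m \<longrightarrow> (\<forall>D\<in>T n. \<forall>D'\<in>T m. Qz_poly D \<noteq> Qz_poly D'))"
proof -
  \<comment> \<open>The sizes \<open>2 * n + 2\<close> are the even numbers from 2 on, as the parity
    computations require.\<close>
  define K where "K n = rosette_diagram (2 * n + 2)" for n
  define T where "T n = diagram_equiv `` {K n}" for n
  have "T n \<in> twisted_knots" for n
    unfolding T_def K_def twisted_knots_def by (rule quotientI) (simp add: is_diagram_rosette)
  moreover have Q: "Q_poly D = 0" if "D \<in> T n" for n D
    using that Q_poly_rosette[of "2 * n + 2"] diagram_equiv_same_polys(1)[of "K n" D]
    by (simp add: T_def K_def)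
  moreover have Qz: "Qz_poly D = of_nat (2 * n + 2) * (var_s - 1)\<^sup>2" if "D \<in> T n" for n D
  proof -
    have "Qz_poly D = Qz_poly (K n)"
      using that diagram_equiv_same_polys(2)[of "K n" D] by (simp add: T_def)
    also have "\<dots> = of_nat (2 * n + 2) * (var_s - 1)\<^sup>2"
      unfolding K_def by (rule Qz_poly_rosette) simp_all
    finally show ?thesis .
  qed
  \<comment> \<open>The polynomial ring is an integral domain of characteristic 0, so different
    multiples of the nonzero square are different.\<close>
  have "Qz_poly D \<noteq> Qz_poly D'" if "n \<noteq> m" "D \<in> T n" "D' \<in> T m" for n m D D'
    unfolding Qz[OF that(2)] Qz[OF that(3)] mult_cancel_right of_nat_eq_iff
    using that(1) var_s_minus_1_neq_0 by simp
  ultimately show ?thesis by (intro exI[of _ T]) metis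
qed

end
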